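(* Let $f,k,\Phi,[a,b],c$ satisfy the standing assumptions in the context, and let $K$, $m$, $M(a,b)$ be as defined there. For $\rho>0$ consider the two conditions $$(\mathrm I^1_\rho):\quad \sup\Bigl\{\frac{f(u)}{\rho}:0\le u\le\rho\Bigr\}<m,\qquad\qquad (\mathrm I^0_\rho):\quad \inf\Bigl\{\frac{f(u)}{\rho}:\rho\le u\le\rho/c\Bigr\}>M(a,b).$$ Consider the integral equation $$u(t)=\int_0^1k(t,s)f(u(s))\,ds,\qquad t\in[0,1].\tag{E}$$ Equation (E) has at least one positive solution in $K$ if either of the following holds: $(S_1)$ there exist $\rho_1,\rho_2\in(0,+\infty)$ with $\rho_1/c<\rho_2$ such that $(\mathrm I^0_{\rho_1})$ and $(\mathrm I^1_{\rho_2})$ hold; $(S_2)$ there exist $\rho_1,\rho_2\in(0,+\infty)$ with $\rho_1<\rho_2$ such that $(\mathrm I^1_{\rho_1})$ and $(\mathrm I^0_{\rho_2})$ hold. Equation (E) has at least two positive solutions in $K$ if one of the following holds: $(S_3)$ there exist $\rho_1,\rho_2,\rho_3\in(0,+\infty)$ with $\rho_1/c<\rho_2<\rho_3$ such that $(\mathrm I^0_{\rho_1})$, $(\mathrm I^1_{\rho_2})$ and $(\mathrm I^0_{\rho_3})$ hold; $(S_4)$ there exist $\rho_1,\rho_2,\rho_3\in(0,+\infty)$ with $\rho_1<\rho_2$ and $\rho_2/c<\rho_3$ such that $(\mathrm I^1_{\rho_1})$, $(\mathrm I^0_{\rho_2})$ and $(\mathrm I^1_{\rho_3})$ hold. Equation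 (E) has at least three positive solutions in $K$ if one of the following holds: $(S_5)$ there exist $\rho_1,\rho_2,\rho_3,\rho_4\in(0,+\infty)$ with $\rho_1/c<\rho_2<\rho_3$ and $\rho_3/c<\rho_4$ such that $(\mathrm I^0_{\rho_1})$, $(\mathrm I^1_{\rho_2})$, $(\mathrm I^0_{\rho_3})$ and $(\mathrm I^1_{\rho_4})$ hold; $(S_6)$ there exist $\rho_1,\rho_2,\rho_3,\rho_4\in(0,+\infty)$ with $\rho_1<\rho_2$ and $\rho_2/c<\rho_3<\rho_4$ such that $(\mathrm I^1_{\rho_1})$, $(\mathrm I^0_{\rho_2})$, $(\mathrm I^1_{\rho_3})$ and $(\mathrm I^0_{\rho_4})$ hold.
   Context: Standing assumptions: $f:[0,+\infty)\to[0,+\infty)$ and $k:[0,1]\times[0,1]\to[0,+\infty)$ are continuous; there exist a continuous function $\Phi:[0,1]\to[0,+\infty)$, an interval $[a,b]\subset[0,1]$ and a constant $c\in(0,1]$ such that $k(t,s)\le\Phi(s)$ for $t,s\in[0,1]$ and $c\,\Phi(s)\le k(t,s)$ for $t\in[a,b]$, $s\in[0,1]$; and $\int_a^b\Phi(s)\,ds>0$. $C[0,1]$ carries the norm $\|u\|=\max_{t\in[0,1]}|u(t)|$, and $$K=\{u\in C[0,1]: u\ge0,\ \min_{t\in[a,b]}u(t)\ge c\|u\|\}.$$ The constants are $\frac1m=\sup_{t\in[0,1]}\int_0^1k(t,s)\,ds$ and $\frac1{M(a,b)}=\inf_{t\in[a,b]}\int_a^bk(t,s)\,ds$. A positive solution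 in $K$ is a solution $u\in K$ with $\|u\|>0$. *)

theory Defs
  imports "HOL-Analysis.Analysis"
begin

text \<open>
  Elements of \<open>C[0,1]\<close> are total functions that are continuous on \<open>{0..1}\<close> and
  equal to \<open>undefined\<close> outside \<open>{0..1}\<close>. Thus two elements are equal iff they agree on \<open>{0..1}\<close>,
  which is what makes counting solutions meaningful.
\<close>

definition C01 :: "(real \<Rightarrow> real) set" where
  "C01 = {u. continuous_on {0..1} u \<and> u \<in> extensional {0..1}}"

text \<open>
  The suprema and infima of \<open>u\<close> below are over nonempty compact sets, on which \<open>u\<close> is
  continuous, so they are attained: they are the maximum and the minimum.
\<close>

definition sup_norm :: "(real \<Rightarrow> real) \<Rightarrow> real" where
  "sup_norm u = (SUP t\<in>{0..1}. \<bar>u t\<bar>)"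

definition cone :: "real \<Rightarrow> real \<Rightarrow> real \<Rightarrow> (real \<Rightarrow> real) set" where
  "cone a b c = {u \<in> C01. (\<forall>t\<in>{0..1}. 0 \<le> u t) \<and> (INF t\<in>{a..b}. u t) \<ge> c * sup_norm u}"

definition m_const :: "(real \<Rightarrow> real \<Rightarrow> real) \<Rightarrow> real" where
  "m_const k = 1 / (SUP t\<in>{0..1}. integral {0..1} (\<lambda>s. k t s))"

definition M_const :: "(real \<Rightarrow> real \<Rightarrow> real) \<Rightarrow> real \<Rightarrow> real \<Rightarrow> real" where
  "M_const k a b = 1 / (INF t\<in>{a..b}. integral {a..b} (\<lambda>s. k t s))"

definition cond_I1 :: "(real \<Rightarrow> real) \<Rightarrow> (real \<Rightarrow> real \<Rightarrow> real) \<Rightarrow> real \<Rightarrow> bool" where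
  "cond_I1 f k \<rho> \<longleftrightarrow> (SUP x\<in>{0..\<rho>}. f x / \<rho>) < m_const k"

definition cond_I0 ::
  "(real \<Rightarrow> real) \<Rightarrow> (real \<Rightarrow> real \<Rightarrow> real) \<Rightarrow> real \<Rightarrow> real \<Rightarrow> real \<Rightarrow> real \<Rightarrow> bool" where
  "cond_I0 f k a b c \<rho> \<longleftrightarrow> (INF x\<in>{\<rho>..\<rho>/c}. f x / \<rho>) > M_const k a b"

definition positive_solutions ::
  "(real \<Rightarrow> real) \<Rightarrow> (real \<Rightarrow> real \<Rightarrow> real) \<Rightarrow> real \<Rightarrow> real \<Rightarrow> real \<Rightarrow> (real \<Rightarrow> real) set" where
  "positive_solutions f k a b c =
     {u \<in> cone a b c. sup_norm u > 0 \<and>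
        (\<forall>t\<in>{0..1}. u t = integral {0..1} (\<lambda>s. k t s * f (u s)))}"

definition has_at_least :: "nat \<Rightarrow> 'a set \<Rightarrow> bool" where
  "has_at_least n A \<longleftrightarrow> (\<exists>S\<subseteq>A. finite S \<and> card S = n)"

end

theory Submission
  imports Defs "HOL-Complex_Analysis.Great_Picard"
begin

text \<open>
  Write \<open>p\<close> for the norm and \<open>q\<close> for the minimum over \<open>[a,b]\<close>. Suppose that
  \<open>p (T x) < \<rho>\<close> whenever \<open>p x = \<rho>\<close> and that \<open>q (T x) > \<sigma>\<close> whenever \<open>q x = \<sigma>\<close>. On each ray of
  the cone the points with \<open>p = \<rho>\<close> and \<open>q = \<sigma>\<close> bound a segment, in whichever order they come;
  parametrise it by \<open>\<tau> \<in> [0,1]\<close>. Instead of fixed point index theory, Schauder's theorem is applied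
  on the pairs (ray, \<open>\<tau>\<close>): the new ray is that of \<open>T x\<close>, and \<open>\<tau>\<close> is moved by
  \<open>\<delta> = P x - P (T x)\<close> with \<open>P = (1 - \<tau>) p + \<tau> q\<close>. The hypotheses give \<open>\<delta> > 0\<close> at \<open>\<tau> = 0\<close> and
  \<open>\<delta> < 0\<close> at \<open>\<tau> = 1\<close>, so a fixed pair has \<open>0 < \<tau> < 1\<close> and \<open>\<delta> = 0\<close>, and then \<open>T x\<close>, being a
  multiple of \<open>x\<close> with the same value of \<open>P\<close>, equals \<open>x\<close>. Both the compressive and the expansive
  case are covered, and the position of \<open>x\<close> relative to \<open>\<rho>\<close> and \<open>\<sigma>\<close> separates the solutions.
\<close>

section \<open>Brouwer's and Schauder's theorems\<close>

lemma tendsto_fun_coordinatewise: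
  fixes X :: "nat \<Rightarrow> 'i \<Rightarrow> 'b::topological_space"
  assumes "\<And>i. (\<lambda>k. X k i) \<longlonglongrightarrow> x i"
  shows "X \<longlonglongrightarrow> x"
proof -
  have "limitin (product_topology (\<lambda>i. euclidean) UNIV) X x sequentially"
    unfolding limitin_componentwise using assms by (simp add: PiE_UNIV_domain)
  then show ?thesis
    by (simp add: euclidean_product_topology)
qed

text \<open>The cube sits inside \<open>nat \<Rightarrow> real\<close>, so that its dimension
  \<open>n\<close> is an ordinary variable, as a finite net of unknown size requires. Kuhn's
  combinatorial lemma on the grid of mesh \<open>1 / p\<close> yields a cell on which, in every
  coordinate, \<open>F y i - y i\<close> is \<ge> 0 at one corner and \<le> 0 at another. Refining
  the grid and using compactness turns this into a fixed point.\<close>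

lemma brouwer_unit_cube:
  fixes F :: "(nat \<Rightarrow> real) \<Rightarrow> nat \<Rightarrow> real" and n :: nat
  defines "Q \<equiv> {..<n} \<rightarrow>\<^sub>E {0..1::real}"
  assumes cont: "continuous_on Q F" and maps: "F \<in> Q \<rightarrow> Q"
  shows "\<exists>x\<in>Q. F x = x"
proof -
  define pt where "pt p x = (\<lambda>i\<in>{..<n}. real (x i) / real p)" for p :: nat and x :: "nat \<Rightarrow> nat"
  define near where "near p z y \<longleftrightarrow> (\<forall>i<n. \<bar>y i - z i\<bar> \<le> 1 / real p)" for p and z y :: "nat \<Rightarrow> real"
  have pt_Q: "pt p x \<in> Q" if "p > 0" "\<forall>i<n. x i \<le> p" for p x
    using that by (auto simp: pt_def Q_def PiE_iff extensional_def)
  have F_Q: "0 \<le> F y i" "F y i \<le> 1" if "y \<in> Q" "i < n" for y i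
    using maps that by (auto simp: Q_def PiE_iff Pi_iff)
  have approx: "\<exists>z\<in>Q. \<forall>i<n. (\<exists>y\<in>Q. near p z y \<and> y i \<le> F y i) \<and> (\<exists>y\<in>Q. near p z y \<and> F y i \<le> y i)"
    if p: "p > 0" for p
  proof -
    \<comment> \<open>Label 0 records that \<open>F\<close> does not decrease coordinate
      \<open>i\<close>, label 1 that it does not increase it. On the faces \<open>x i = 0\<close>
      and \<open>x i = p\<close> the label is forced to the values that Kuhn's lemma prescribes;
      this agrees with the reading because \<open>F\<close> maps into the cube.\<close>
    define label where "label x i = (if x i = p \<or> x i \<noteq> 0 \<and> F (pt p x) i < pt p x i then 1 else 0::nat)"
      for x i
    have up: "pt p x i \<le> F (pt p x) i" if "label x i = 0" "i < n" "\<forall>i<n. x i \<le> p" for x i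
      using that F_Q[OF pt_Q[OF p that(3)] that(2)]
      by (auto simp: label_def pt_def split: if_splits)
    have down: "F (pt p x) i \<le> pt p x i" if "label x i \<noteq> 0" "i < n" "\<forall>i<n. x i \<le> p" for x i
      using that F_Q[OF pt_Q[OF p that(3)] that(2)] p
      by (auto simp: label_def pt_def split: if_splits)
    obtain q where q: "\<forall>i<n. q i < p"
      and rs: "\<forall>i<n. \<exists>r s. (\<forall>j<n. q j \<le> r j \<and> r j \<le> q j + 1) \<and>
        (\<forall>j<n. q j \<le> s j \<and> s j \<le> q j + 1) \<and> label r i \<noteq> label s i"
      by (rule kuhn_lemma[of p n label]) (use p in \<open>auto simp: label_def\<close>)
    have nr: "near p (pt p q) (pt p r)" if qr: "\<forall>j<n. q j \<le> r j \<and> r j \<le> q j + 1" for r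
    proof -
      have "\<bar>real (r i) / real p - real (q i) / real p\<bar> \<le> 1 / real p" if "i < n" for i
      proof -
        have "\<bar>real (r i) - real (q i)\<bar> \<le> 1"
          using qr that by fastforce
        then show ?thesis
          using p by (simp add: diff_divide_distrib[symmetric] divide_right_mono)
      qed
      then show ?thesis by (simp add: near_def pt_def)
    qed
    show ?thesis
    proof (intro bexI allI impI)
      show "pt p q \<in> Q" using pt_Q[OF p] q by (simp add: less_imp_le)
      fix i assume i: "i < n"
      then obtain r s where r: "\<forall>j<n. q j \<le> r j \<and> r j \<le> q j + 1"
        and s: "\<forall>j<n. q j \<le> s j \<and> s j \<le> q j + 1" and "label r i \<noteq> label s i"
        using rs by blast
      then have lab: "label r i = 0 \<and> label s i \<noteq> 0 \<or> label s i = 0 \<and> label r i \<noteq> 0"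
        by (auto simp: label_def split: if_splits)
      have rp: "\<forall>i<n. r i \<le> p" "\<forall>i<n. s i \<le> p"
        using r s q by (metis Suc_eq_plus1 Suc_leI le_trans)+
      show "(\<exists>y\<in>Q. near p (pt p q) y \<and> y i \<le> F y i) \<and> (\<exists>y\<in>Q. near p (pt p q) y \<and> F y i \<le> y i)"
        using lab up[OF _ i] down[OF _ i] rp pt_Q[OF p] nr r s by meson
    qed
  qed
  then have "\<forall>k. \<exists>z. z \<in> Q \<and> (\<forall>i<n. (\<exists>y\<in>Q. near (Suc k) z y \<and> y i \<le> F y i) \<and>
      (\<exists>y\<in>Q. near (Suc k) z y \<and> F y i \<le> y i))"
    by blast
  then obtain Z where Z: "\<And>k. Z k \<in> Q"
    and ZF: "\<And>k i. i < n \<Longrightarrow> (\<exists>y\<in>Q. near (Suc k) (Z k) y \<and> y i \<le> F y i) \<and>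
      (\<exists>y\<in>Q. near (Suc k) (Z k) y \<and> F y i \<le> y i)"
    by (auto dest!: choice)
  \<comment> \<open>All coordinates are bounded by 1 and there are finitely many, so a single
    subsequence makes all of them converge.\<close>
  obtain \<sigma> where \<sigma>: "strict_mono (\<sigma> :: nat \<Rightarrow> nat)"
    and "\<And>i. i \<in> {..<n} \<Longrightarrow> \<exists>l. (\<lambda>k. Z (\<sigma> k) i) \<longlonglongrightarrow> l"
    by (rule function_convergent_subsequence[of "{..<n}" Z 1])
       (use Z in \<open>auto simp: Q_def PiE_iff countable_finite\<close>)
  then obtain x0 where x0: "\<And>i. i < n \<Longrightarrow> (\<lambda>k. Z (\<sigma> k) i) \<longlonglongrightarrow> x0 i"
    by (metis lessThan_iff)
  define x where "x = (\<lambda>i\<in>{..<n}. x0 i)"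
  have x: "(\<lambda>k. Z (\<sigma> k) i) \<longlonglongrightarrow> x i" if "i < n" for i
    using x0 that by (simp add: x_def)
  have xQ: "x \<in> Q"
    unfolding Q_def
  proof (rule PiE_I)
    fix i assume "i \<in> {..<n}"
    then show "x i \<in> {0..1}"
      using Z by (intro closed_sequentially[OF _ _ x]) (auto simp: Q_def PiE_iff)
  qed (simp add: x_def)
  have inv0: "(\<lambda>k. 1 / real (Suc (\<sigma> k))) \<longlonglongrightarrow> 0"
    using LIMSEQ_subseq_LIMSEQ[OF LIMSEQ_Suc[OF lim_1_over_n] \<sigma>] by (simp add: comp_def)
  \<comment> \<open>Any choice of points from the shrinking cells has the same limit
    \<open>x\<close>. Beyond coordinate \<open>n\<close> all members of \<open>Q\<close> share the
    value \<open>undefined\<close>, so coordinatewise convergence is trivial there.\<close>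
  have lim: "Y \<longlonglongrightarrow> x" if Y: "\<And>k. Y k \<in> Q" "\<And>k. near (Suc (\<sigma> k)) (Z (\<sigma> k)) (Y k)" for Y
  proof (rule tendsto_fun_coordinatewise)
    fix i
    show "(\<lambda>k. Y k i) \<longlonglongrightarrow> x i"
    proof (cases "i < n")
      case True
      have "(\<lambda>k. Y k i - Z (\<sigma> k) i) \<longlonglongrightarrow> 0"
        by (rule Lim_null_comparison[OF _ inv0]) (use Y(2) True in \<open>auto simp: near_def\<close>)
      from tendsto_add[OF this x[OF True]] show ?thesis by simp
    next
      case False
      then have "Y k i = x i" for k using Y(1)[of k] by (auto simp: Q_def PiE_iff extensional_def x_def)
      then show ?thesis by simp
    qed
  qed
  have limF: "(\<lambda>k. F (Y k) i) \<longlonglongrightarrow> F x i" if "\<And>k. Y k \<in> Q" "Y \<longlonglongrightarrow> x" for Y i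
  proof -
    have "continuous_on Q (\<lambda>y. F y i)"
      using cont by (rule continuous_on_product_then_coordinatewise)
    from continuous_on_tendsto_compose[OF this that(2) xQ] show ?thesis
      using that(1) by simp
  qed
  have lim_i: "(\<lambda>k. Y k i) \<longlonglongrightarrow> x i" if "Y \<longlonglongrightarrow> x" for Y i
    by (rule continuous_on_tendsto_compose[where s=UNIV and f="\<lambda>y. y i", OF _ that])
       (auto intro: continuous_on_product_then_coordinatewise continuous_on_id)
  \<comment> \<open>Two sequences from the cells, one for each sign of \<open>F y i - y i\<close>,
    both converge to \<open>x\<close>; the weak inequalities survive in the limit.\<close>
  have "F x i = x i" if i: "i < n" for i
  proof (rule antisym)
    have "\<forall>k. \<exists>y. y \<in> Q \<and> near (Suc (\<sigma> k)) (Z (\<sigma> k)) y \<and> F (y) i \<le> y i"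
      using ZF[OF i] by blast
    then obtain Y where Y: "\<And>k. Y k \<in> Q" "\<And>k. near (Suc (\<sigma> k)) (Z (\<sigma> k)) (Y k)"
      "\<And>k. F (Y k) i \<le> Y k i"
      by (auto dest!: choice)
    show "F x i \<le> x i"
      using LIMSEQ_le[OF limF lim_i] lim[OF Y(1,2)] Y by blast
    have "\<forall>k. \<exists>y. y \<in> Q \<and> near (Suc (\<sigma> k)) (Z (\<sigma> k)) y \<and> y i \<le> F (y) i"
      using ZF[OF i] by blast
    then obtain Y where Y: "\<And>k. Y k \<in> Q" "\<And>k. near (Suc (\<sigma> k)) (Z (\<sigma> k)) (Y k)"
      "\<And>k. Y k i \<le> F (Y k) i"
      by (auto dest!: choice)
    show "x i \<le> F x i"
      using LIMSEQ_le[OF lim_i limF] lim[OF Y(1,2)] Y by blast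
  qed
  moreover have "F x i = x i" if "\<not> i < n" for i
    using maps xQ that by (auto simp: Q_def PiE_iff Pi_iff extensional_def)
  ultimately show ?thesis using xQ by blast
qed

text \<open>Points of a finite \<open>e\<close>-net of \<open>S\<close> are combined with weights
  from a cube. Composing with \<open>T\<close> and reading off partition-of-unity coordinates gives
  a map of the cube, and Brouwer's fixed weights yield a point moved by at most \<open>e\<close>.
  Compactness of \<open>S\<close> then allows \<open>e\<close> to tend to 0.\<close>

lemma schauder:
  fixes T :: "'a::real_normed_vector \<Rightarrow> 'a"
  assumes C: "convex C" "C \<noteq> {}" and cont: "continuous_on C T"
    and TS: "T ` C \<subseteq> S" and S: "compact S" "S \<subseteq> C"
  shows "\<exists>x\<in>C. T x = x"
proof -
  have approx: "\<exists>x\<in>C. dist x (T x) \<le> e" if e: "e > 0" for e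
  proof -
    obtain N where N: "finite N" "N \<subseteq> S" "S \<subseteq> (\<Union>x\<in>N. ball x e)"
      by (rule compactE_image[OF S(1), of S "\<lambda>x. ball x e"]) (use e in auto)
    then obtain n :: nat and z where z: "z ` {..<n} = N"
      by (metis finite_imp_nat_seg_image_inj_on lessThan_def)
    \<comment> \<open>The weights below rely on the point \<open>z 0\<close>. The net is nonempty
      because \<open>C\<close>, and hence \<open>S\<close>, is.\<close>
    have n: "n > 0"
    proof (rule ccontr)
      assume "\<not> n > 0"
      then show False using N z C(2) TS by auto
    qed
    have zC: "z i \<in> C" if "i < n" for i using z that N(2) S(2) by blast
    define Q where "Q = {..<n} \<rightarrow>\<^sub>E {0..1::real}"
    define tot where "tot y = (\<Sum>i<n. y i)" for y :: "nat \<Rightarrow> real"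
    \<comment> \<open>The correction at \<open>i = 0\<close> makes the weights sum to 1 on the whole cube, in particular at 0.\<close>
    define w where "w y i = (y i + (if i = 0 then max 0 (1 - tot y) else 0)) / max 1 (tot y)"
      for y i
    define \<xi> where "\<xi> y = (\<Sum>i<n. w y i *\<^sub>R z i)" for y
    \<comment> \<open>Tent functions supported on the balls of the net; normalised, they form
      Schauder's partition of unity, and \<open>F\<close> replaces the weights \<open>y\<close> by
      the coordinates of \<open>T (\<xi> y)\<close> in it.\<close>
    define \<phi> where "\<phi> i v = max 0 (e - dist v (z i))" for i v
    define F where "F y = (\<lambda>i\<in>{..<n}. \<phi> i (T (\<xi> y)) / (\<Sum>j<n. \<phi> j (T (\<xi> y))))" for y
    have w0: "w y i \<ge> 0" if "y \<in> Q" "i < n" for y i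
      using that by (auto simp: w_def Q_def PiE_iff intro!: divide_nonneg_nonneg add_nonneg_nonneg)
    have w1: "(\<Sum>i<n. w y i) = 1" for y
    proof -
      have "(\<Sum>i<n. w y i) = (tot y + max 0 (1 - tot y)) / max 1 (tot y)"
        using n by (simp add: w_def sum_divide_distrib[symmetric] sum.distrib tot_def)
      also have "tot y + max 0 (1 - tot y) = max 1 (tot y)" by simp
      finally show ?thesis by simp
    qed
    have \<xi>C: "\<xi> y \<in> C" if "y \<in> Q" for y
      unfolding \<xi>_def using C(1) w1 w0[OF that] zC by (intro convex_sum) auto
    have co: "continuous_on Q (\<lambda>y. y i)" for i
      by (auto intro: continuous_on_product_then_coordinatewise continuous_on_id)
    have c\<xi>: "continuous_on Q \<xi>"
    proof -
      have ctot: "continuous_on Q tot" unfolding tot_def by (intro continuous_intros co)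
      have "continuous_on Q (\<lambda>y. if i = 0 then max 0 (1 - tot y) else 0)" for i :: nat
        using ctot by (cases "i = 0") (auto intro!: continuous_intros)
      then show ?thesis
        unfolding \<xi>_def w_def by (intro continuous_intros co ctot) auto
    qed
    have cT: "continuous_on Q (\<lambda>y. T (\<xi> y))"
      by (rule continuous_on_compose2[OF cont c\<xi>]) (use \<xi>C in auto)
    have pos: "(\<Sum>j<n. \<phi> j (T (\<xi> y))) > 0" if y: "y \<in> Q" for y
    proof -
      have "T (\<xi> y) \<in> S" using TS \<xi>C[OF y] by blast
      then obtain i where "i < n" "T (\<xi> y) \<in> ball (z i) e"
        using N(3) z by blast
      then have "\<phi> i (T (\<xi> y)) > 0" by (simp add: \<phi>_def dist_commute)
      then show ?thesis
        using \<open>i < n\<close> by (intro sum_pos2[of _ i]) (auto simp: \<phi>_def)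
    qed
    have "continuous_on Q F"
      unfolding F_def
    proof (rule continuous_on_coordinatewise_then_product)
      fix i
      have "continuous_on Q (\<lambda>y. \<phi> i (T (\<xi> y)) / (\<Sum>j<n. \<phi> j (T (\<xi> y))))"
        using pos unfolding \<phi>_def by (intro continuous_intros cT) (metis less_irrefl)
      then show "continuous_on Q (\<lambda>y. (\<lambda>i\<in>{..<n}. \<phi> i (T (\<xi> y)) / (\<Sum>j<n. \<phi> j (T (\<xi> y)))) i)"
        by (cases "i < n") auto
    qed
    moreover have "F \<in> Q \<rightarrow> Q"
    proof
      fix y assume y: "y \<in> Q"
      have "\<phi> i v \<le> (\<Sum>j<n. \<phi> j v)" if "i < n" for i v
        using that by (intro member_le_sum) (auto simp: \<phi>_def)
      then show "F y \<in> Q"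
        using pos[OF y] by (auto simp: Q_def F_def divide_le_eq_1 \<phi>_def)
    qed
    ultimately obtain y where y: "y \<in> Q" "F y = y"
      using brouwer_unit_cube[of n F] unfolding Q_def by blast
    let ?v = "T (\<xi> y)"
    have yi: "y i = \<phi> i ?v / (\<Sum>j<n. \<phi> j ?v)" if "i < n" for i
      using that fun_cong[OF y(2), of i] by (simp add: F_def)
    then have tot1: "tot y = 1"
      using pos[OF y(1)] by (simp add: tot_def sum_divide_distrib[symmetric])
    then have wy: "w y i = y i" for i by (simp add: w_def)
    \<comment> \<open>At the fixed weights the total is 1, so \<open>\<xi> y - ?v\<close> is an
      average of the vectors \<open>z i - ?v\<close>; a nonzero weight occurs only where
      \<open>\<phi> i ?v > 0\<close>, that is, where \<open>z i\<close> is within \<open>e\<close>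
      of \<open>?v\<close>.\<close>
    have "\<xi> y - ?v = (\<Sum>i<n. y i *\<^sub>R (z i - ?v))"
      using tot1 by (simp add: \<xi>_def wy scaleR_diff_right sum_subtractf scaleR_sum_left[symmetric] tot_def)
    also have "norm \<dots> \<le> (\<Sum>i<n. y i * e)"
    proof (rule sum_norm_le)
      fix i assume i: "i \<in> {..<n}"
      have "y i \<ge> 0" using y(1) i by (auto simp: Q_def PiE_iff)
      moreover have "norm (z i - ?v) \<le> e" if "y i \<noteq> 0"
        using yi[of i] i that by (auto simp: \<phi>_def max_def dist_norm norm_minus_commute split: if_splits)
      ultimately show "norm (y i *\<^sub>R (z i - ?v)) \<le> y i * e"
        by (cases "y i = 0") (auto intro: mult_left_mono)
    qed
    also have "\<dots> = e" using tot1 by (simp add: tot_def sum_distrib_right[symmetric])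
    finally show ?thesis using \<xi>C[OF y(1)] by (auto simp: dist_norm)
  qed
  have "\<exists>X. \<forall>k. X k \<in> C \<and> dist (X k) (T (X k)) \<le> 1 / real (Suc k)"
    using approx by (intro choice allI) (metis of_nat_0_less_iff zero_less_Suc zero_less_divide_1_iff)
  then obtain X where X: "\<And>k. X k \<in> C" "\<And>k. dist (X k) (T (X k)) \<le> 1 / real (Suc k)"
    by blast
  have "T (X k) \<in> S" for k using X TS by blast
  \<comment> \<open>Only the images \<open>T (X k)\<close> lie in a compact set; the points
    \<open>X k\<close> inherit their limit because the differences tend to 0.\<close>
  then obtain x r where x: "x \<in> S" and r: "strict_mono r" and lim: "((\<lambda>k. T (X k)) \<circ> r) \<longlonglongrightarrow> x"
    using S(1) by (metis compact_def)
  have "(\<lambda>k. X (r k) - T (X (r k))) \<longlonglongrightarrow> 0"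
  proof (rule Lim_null_comparison)
    show "(\<lambda>k. 1 / real (Suc (r k))) \<longlonglongrightarrow> 0"
      using LIMSEQ_subseq_LIMSEQ[OF LIMSEQ_Suc[OF lim_1_over_n] r] by (simp add: comp_def)
  qed (use X(2) in \<open>auto simp: dist_norm\<close>)
  from tendsto_add[OF this lim[unfolded comp_def]] have "(\<lambda>k. X (r k)) \<longlonglongrightarrow> x" by simp
  then have "(\<lambda>k. T (X (r k))) \<longlonglongrightarrow> T x"
    using continuous_on_tendsto_compose[OF cont] x S(2) X(1) by (metis eventually_sequentiallyI subsetD)
  then have "T x = x" using lim LIMSEQ_unique unfolding comp_def by blast
  then show ?thesis using x S(2) by blast
qed

section \<open>Fixed points in a cone\<close>

text \<open>In the application \<open>p\<close> and \<open>q\<close> are a maximum and a minimum,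
  which are not additive. The additive functional \<open>l\<close> squeezed between them is what
  makes the set of encoded pairs convex. The direction \<open>e\<close> raises \<open>p\<close> and
  \<open>q\<close> by equal amounts and so shifts every mixture \<open>P\<close> in a controlled
  way.\<close>

lemma cone_fixed_point_between:
  fixes K :: "'a::real_normed_vector set" and T :: "'a \<Rightarrow> 'a" and p q l :: "'a \<Rightarrow> real"
  assumes K_add: "\<And>x y. x \<in> K \<Longrightarrow> y \<in> K \<Longrightarrow> x + y \<in> K"
    and K_scale: "\<And>r x. 0 \<le> r \<Longrightarrow> x \<in> K \<Longrightarrow> r *\<^sub>R x \<in> K"
    and e: "e \<in> K"
    and cont: "continuous_on K p" "continuous_on K q" "continuous_on K l"
    and p_scale: "\<And>r x. 0 \<le> r \<Longrightarrow> x \<in> K \<Longrightarrow> p (r *\<^sub>R x) = r * p x"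
    and q_scale: "\<And>r x. 0 \<le> r \<Longrightarrow> x \<in> K \<Longrightarrow> q (r *\<^sub>R x) = r * q x"
    and l_scale: "\<And>r x. 0 \<le> r \<Longrightarrow> x \<in> K \<Longrightarrow> l (r *\<^sub>R x) = r * l x"
    and l_add: "\<And>x y. x \<in> K \<Longrightarrow> y \<in> K \<Longrightarrow> l (x + y) = l x + l y"
    and p_shift: "\<And>r x. 0 \<le> r \<Longrightarrow> x \<in> K \<Longrightarrow> p (x + r *\<^sub>R e) = p x + r"
    and q_shift: "\<And>r x. 0 \<le> r \<Longrightarrow> x \<in> K \<Longrightarrow> q (x + r *\<^sub>R e) = q x + r"
    and l_e: "l e = 1"
    and c: "0 < c"
    and p_nonneg: "\<And>x. x \<in> K \<Longrightarrow> 0 \<le> p x"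
    and p_q: "\<And>x. x \<in> K \<Longrightarrow> c * p x \<le> q x"
    and q_l: "\<And>x. x \<in> K \<Longrightarrow> q x \<le> l x" and l_p: "\<And>x. x \<in> K \<Longrightarrow> l x \<le> p x"
    and T_K: "\<And>x. x \<in> K \<Longrightarrow> T x \<in> K" and T_cont: "continuous_on K T"
    and T_compact: "\<And>R. \<exists>S. compact S \<and> S \<subseteq> K \<and> T ` {x \<in> K. p x \<le> R} \<subseteq> S"
    and K_closed: "closed K"
    and \<rho>: "0 < \<rho>" "\<And>x. x \<in> K \<Longrightarrow> p x = \<rho> \<Longrightarrow> p (T x) < \<rho>"
    and \<sigma>: "0 < \<sigma>" "\<And>x. x \<in> K \<Longrightarrow> q x = \<sigma> \<Longrightarrow> \<sigma> < q (T x)"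
  shows "\<exists>x\<in>K. T x = x \<and> 0 < p x \<and> (\<rho> < \<sigma> \<longrightarrow> \<rho> < p x \<and> q x < \<sigma>) \<and>
    (\<sigma> < c * \<rho> \<longrightarrow> \<sigma> < q x \<and> p x < \<rho>)"
proof -
  \<comment> \<open>A point of \<open>C\<close> encodes a pair: its ray, and \<open>\<tau> v = l v - 1 \<in> [0,1]\<close>.\<close>
  define C where "C = {v \<in> K. 1 \<le> l v \<and> l v \<le> 2}"
  define \<tau> where "\<tau> v = l v - 1" for v
  \<comment> \<open>The factor \<open>s v\<close> interpolates between the one that puts the ray of
    \<open>v\<close> at level \<open>p = \<rho>\<close> (for \<open>\<tau> v = 0\<close>) and the
    one that puts it at \<open>q = \<sigma>\<close> (for \<open>\<tau> v = 1\<close>).\<close>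
  define s where "s v = (1 - \<tau> v) * \<rho> / p v + \<tau> v * \<sigma> / q v" for v
  define U where "U v = s v *\<^sub>R v" for v
  define P where "P v x = (1 - \<tau> v) * p x + \<tau> v * q x" for v x
  define \<delta> where "\<delta> v = P v (U v) - P v (T (U v))" for v
  \<comment> \<open>\<open>T (U v)\<close> may vanish and then has no ray; the added multiple of \<open>e\<close> repairs this and
    disappears once \<open>\<delta> v = 0\<close>.\<close>
  define Y where "Y v = T (U v) + max 0 (\<delta> v) *\<^sub>R e" for v
  \<comment> \<open>The move of \<open>\<tau>\<close> by \<open>\<delta>\<close> is truncated to
    [0,1]; \<open>G\<close> then rescales \<open>Y v\<close> so that its \<open>l\<close>-value
    encodes the new parameter \<open>\<theta> v\<close>.\<close>
  define \<theta> where "\<theta> v = max 0 (min 1 (\<tau> v + \<delta> v))" for v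
  define G where "G v = ((1 + \<theta> v) / l (Y v)) *\<^sub>R Y v" for v
  have CK: "v \<in> K" if "v \<in> C" for v using that by (simp add: C_def)
  have q_p: "q x \<le> p x" if "x \<in> K" for x using q_l l_p that by force
  have \<tau>: "0 \<le> \<tau> v" "\<tau> v \<le> 1" if "v \<in> C" for v using that by (auto simp: \<tau>_def C_def)
  have p1: "1 \<le> p v" if "v \<in> C" for v using that l_p[of v] by (auto simp: C_def)
  have qc: "c \<le> q v" if "v \<in> C" for v
  proof -
    have "c * 1 \<le> c * p v" using p1[OF that] c by (intro mult_left_mono) auto
    then show ?thesis using p_q[OF CK[OF that]] by simp
  qed
  have q2: "q v \<le> 2" if "v \<in> C" for v using that q_l[of v] by (auto simp: C_def)
  have p2: "p v \<le> 2 / c" if "v \<in> C" for v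
    using p_q[OF CK[OF that]] q2[OF that] c by (simp add: field_simps)
  have ppos: "0 < p v" "0 < q v" if "v \<in> C" for v using p1[OF that] qc[OF that] c by auto
  \<comment> \<open>A lower bound for \<open>l (Y v)\<close>. Reading outwards, the factors
    \<open>c\<close> come from \<open>p v \<le> 2 / c\<close> in the bound for \<open>s v\<close>,
    from \<open>c \<le> q v\<close>, and from \<open>c * p \<le> q \<le> l\<close>.\<close>
  define \<mu> where "\<mu> = c * (c * (c * min \<rho> \<sigma> / 2))"
  have \<mu>: "0 < \<mu>" using c \<rho>(1) \<sigma>(1) by (simp add: \<mu>_def)
  have sK: "U v \<in> K" "c * (c * min \<rho> \<sigma> / 2) \<le> q (U v)" "p (U v) \<le> (\<rho> + \<sigma> / c) * (2 / c)"
    "0 < s v" "p (U v) = s v * p v" "q (U v) = s v * q v" if v: "v \<in> C" for v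
  proof -
    have "c * min \<rho> \<sigma> / 2 \<le> \<rho> / p v"
    proof -
      have "c * min \<rho> \<sigma> / 2 \<le> \<rho> / (2 / c)" using c by (simp add: min_def)
      also have "\<dots> \<le> \<rho> / p v" using p2[OF v] ppos[OF v] \<rho>(1) c by (intro divide_left_mono) auto
      finally show ?thesis .
    qed
    moreover have "c * min \<rho> \<sigma> / 2 \<le> \<sigma> / q v"
    proof -
      have "c * min \<rho> \<sigma> / 2 \<le> \<sigma> / (2 / c)" using c by (simp add: min_def)
      also have "\<dots> \<le> \<sigma> / q v"
        using p2[OF v] q_p[OF CK[OF v]] ppos[OF v] \<sigma>(1) c by (intro divide_left_mono) auto
      finally show ?thesis .
    qed
    ultimately have "(1 - \<tau> v) * (c * min \<rho> \<sigma> / 2) + \<tau> v * (c * min \<rho> \<sigma> / 2)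
        \<le> (1 - \<tau> v) * (\<rho> / p v) + \<tau> v * (\<sigma> / q v)"
      using \<tau>[OF v] by (intro add_mono mult_left_mono) auto
    then have s1: "c * min \<rho> \<sigma> / 2 \<le> s v" unfolding s_def distrib_right[symmetric] by simp
    then show s0: "0 < s v" using c \<rho>(1) \<sigma>(1) by (smt (verit) divide_pos_pos min_less_iff_conj mult_pos_pos)
    show "U v \<in> K" using K_scale s0 CK[OF v] by (simp add: U_def)
    show pU: "p (U v) = s v * p v" and qU: "q (U v) = s v * q v"
      using p_scale q_scale s0 CK[OF v] by (simp_all add: U_def)
    have "c * (c * min \<rho> \<sigma> / 2) \<le> q v * s v" using s1 qc[OF v] c s0 \<rho>(1) \<sigma>(1)
      by (intro mult_mono) auto
    then show "c * (c * min \<rho> \<sigma> / 2) \<le> q (U v)" by (simp add: qU mult.commute)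
    have "(1 - \<tau> v) * (\<rho> / p v) \<le> 1 * (\<rho> / 1)" "\<tau> v * (\<sigma> / q v) \<le> 1 * (\<sigma> / c)"
      using \<tau>[OF v] ppos[OF v] p1[OF v] qc[OF v] \<rho>(1) \<sigma>(1) c
      by (intro mult_mono divide_left_mono; simp)+
    then have "s v \<le> \<rho> + \<sigma> / c" by (simp add: s_def)
    then show "p (U v) \<le> (\<rho> + \<sigma> / c) * (2 / c)"
      unfolding pU using p2[OF v] ppos[OF v] s0 by (intro mult_mono) auto
  qed
  have TU: "T (U v) \<in> K" if "v \<in> C" for v using T_K sK(1) that by blast
  have Pq: "q x \<le> P v x" "P v x \<le> p x" if "v \<in> C" "x \<in> K" for v x
  proof -
    have "\<tau> v * q x \<le> \<tau> v * p x" "(1 - \<tau> v) * q x \<le> (1 - \<tau> v) * p x"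
      using \<tau>[OF that(1)] q_p[OF that(2)] by (auto intro: mult_left_mono)
    then show "q x \<le> P v x" "P v x \<le> p x" by (simp_all add: P_def algebra_simps)
  qed
  have YK: "Y v \<in> K" and lY: "\<mu> \<le> l (Y v)" if v: "v \<in> C" for v
  proof -
    show YK: "Y v \<in> K" unfolding Y_def using TU[OF v] e by (intro K_add K_scale) auto
    \<comment> \<open>Since \<open>e\<close> shifts \<open>p\<close> and \<open>q\<close> alike,
      \<open>P v (Y v)\<close> is the larger of \<open>P v (T (U v))\<close> and
      \<open>P v (U v)\<close>; the latter keeps \<open>Y v\<close> away from 0.\<close>
    have "P v (Y v) = P v (T (U v)) + max 0 (\<delta> v)"
      unfolding P_def Y_def using TU[OF v] by (simp add: p_shift q_shift algebra_simps)
    then have "P v (U v) \<le> P v (Y v)" by (simp add: \<delta>_def)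
    also have "\<dots> \<le> p (Y v)" using Pq(2) v YK by blast
    finally have "c * (c * min \<rho> \<sigma> / 2) \<le> p (Y v)"
      using sK(2)[OF v] Pq(1)[OF v sK(1)[OF v]] by simp
    then have "\<mu> \<le> c * p (Y v)" using c by (simp add: \<mu>_def)
    then show "\<mu> \<le> l (Y v)" using p_q[OF YK] q_l[OF YK] by simp
  qed
  have \<theta>01: "0 \<le> \<theta> v" "\<theta> v \<le> 1" for v by (auto simp: \<theta>_def)
  have GK: "G v \<in> K" and lG: "l (G v) = 1 + \<theta> v" if v: "v \<in> C" for v
  proof -
    have "0 \<le> (1 + \<theta> v) / l (Y v)" using \<theta>01[of v] lY[OF v] \<mu> by simp
    then show "G v \<in> K" "l (G v) = 1 + \<theta> v"
      unfolding G_def using YK[OF v] lY[OF v] \<mu> by (auto simp: K_scale l_scale)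
  qed
  have GC: "G v \<in> C" if "v \<in> C" for v
    using GK[OF that] lG[OF that] \<theta>01[of v] by (simp add: C_def)

  have C_closed: "closed C"
  proof -
    have "C = K \<inter> l -` {1..2}" by (auto simp: C_def)
    then show ?thesis using continuous_closed_preimage[OF cont(3) K_closed closed_atLeastAtMost] by simp
  qed
  have C_convex: "convex C"
  proof (rule convexI)
    fix x y :: 'a and u v :: real
    assume *: "x \<in> C" "y \<in> C" "0 \<le> u" "0 \<le> v" "u + v = 1"
    have xy: "u *\<^sub>R x \<in> K" "v *\<^sub>R y \<in> K" using * CK by (auto intro: K_scale)
    have "l (u *\<^sub>R x + v *\<^sub>R y) = u * l x + v * l y"
      using * CK xy by (simp add: l_add l_scale)
    moreover have "u * 1 + v * 1 \<le> u * l x + v * l y" "u * l x + v * l y \<le> u * 2 + v * 2"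
      using * by (intro add_mono mult_left_mono; simp add: C_def)+
    ultimately show "u *\<^sub>R x + v *\<^sub>R y \<in> C"
      using * xy K_add by (simp add: C_def flip: distrib_right)
  qed
  have C_nonempty: "C \<noteq> {}" using e l_e by (auto simp: C_def intro!: exI[of _ e])
  \<comment> \<open>To place the values of \<open>G\<close> in a compact set, \<open>G v\<close> is
    written as a continuous function of \<open>T (U v)\<close>, the shift along \<open>e\<close> and
    the target \<open>l\<close>-value. These range over a compact \<open>S\<close> and two bounded
    intervals, because \<open>p (U v) \<le> R\<close> bounds both the argument of \<open>T\<close>
    and \<open>\<delta> v\<close>.\<close>
  define R where "R = (\<rho> + \<sigma> / c) * (2 / c)"
  obtain S where S: "compact S" "S \<subseteq> K" "T ` {x \<in> K. p x \<le> R} \<subseteq> S" using T_compact by blast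
  define D where "D = S \<times> {0..R} \<times> {1..2::real}"
  \<comment> \<open>\<open>max \<mu>\<close> changes nothing on the values used, but makes \<open>H\<close> continuous on all of \<open>D\<close>.\<close>
  define H where "H = (\<lambda>(x, d, t). (t / max \<mu> (l (x + d *\<^sub>R e))) *\<^sub>R (x + d *\<^sub>R e))"
  have DK: "fst z + fst (snd z) *\<^sub>R e \<in> K" if "z \<in> D" for z
    using that S(2) e unfolding D_def by (intro K_add K_scale) auto
  have cH: "continuous_on D H"
  proof -
    have a: "continuous_on D (\<lambda>z. fst z + fst (snd z) *\<^sub>R e)" by (intro continuous_intros)
    have b: "continuous_on D (\<lambda>z. l (fst z + fst (snd z) *\<^sub>R e))"
      by (rule continuous_on_compose2[OF cont(3) a]) (use DK in auto)
    show ?thesis unfolding H_def case_prod_beta using \<mu>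
      by (intro continuous_intros a b) (smt (verit))
  qed
  have "compact D" unfolding D_def using S(1) by (intro compact_Times) auto
  then have "compact (H ` D \<inter> C)"
    using compact_Int_closed[OF compact_continuous_image[OF cH] C_closed] by blast
  moreover have "G ` C \<subseteq> H ` D \<inter> C"
  proof safe
    fix v assume v: "v \<in> C"
    have UR: "p (U v) \<le> R" using sK(3)[OF v] by (simp add: R_def)
    then have "T (U v) \<in> S" using S(3) sK(1)[OF v] by blast
    moreover have "\<delta> v \<le> R"
    proof -
      have "0 \<le> P v (T (U v))" using Pq(1)[OF v TU[OF v]] p_q[OF TU[OF v]] p_nonneg[OF TU[OF v]] c
        by (smt (verit) mult_nonneg_nonneg)
      then show ?thesis using Pq(2)[OF v sK(1)[OF v]] UR by (simp add: \<delta>_def)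
    qed
    moreover have "0 \<le> R" using c \<rho>(1) \<sigma>(1) by (simp add: R_def)
    ultimately have "(T (U v), max 0 (\<delta> v), 1 + \<theta> v) \<in> D"
      using \<theta>01[of v] by (simp add: D_def)
    moreover have "G v = H (T (U v), max 0 (\<delta> v), 1 + \<theta> v)"
      using lY[OF v] by (simp add: G_def H_def flip: Y_def)
    ultimately show "G v \<in> H ` D" by blast
  qed (use GC in auto)
  moreover have "continuous_on C G"
  proof -
    have cl: "continuous_on C p" "continuous_on C q" "continuous_on C l"
      using cont CK by (auto intro: continuous_on_subset)
    have c\<tau>: "continuous_on C \<tau>" unfolding \<tau>_def by (intro continuous_intros cl)
    have cU: "continuous_on C U" unfolding U_def s_def
      using ppos by (intro continuous_intros cl c\<tau>) (metis less_irrefl)+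
    have cTU: "continuous_on C (\<lambda>v. T (U v))"
      by (rule continuous_on_compose2[OF T_cont cU]) (use sK in auto)
    have co: "continuous_on C (\<lambda>v. g (h v))" if "continuous_on K g" "continuous_on C h" "\<And>v. v \<in> C \<Longrightarrow> h v \<in> K"
      for g :: "'a \<Rightarrow> real" and h using that by (auto intro: continuous_on_compose2)
    have c\<delta>: "continuous_on C \<delta>" unfolding \<delta>_def P_def
      by (intro continuous_intros co[OF cont(1)] co[OF cont(2)] c\<tau> cU cTU) (use sK TU in auto)
    have cY: "continuous_on C Y" unfolding Y_def by (intro continuous_intros cTU c\<delta>)
    have "\<forall>v\<in>C. l (Y v) \<noteq> 0" using lY \<mu> by fastforce
    then show ?thesis unfolding G_def \<theta>_def
      by (intro continuous_intros cY c\<delta> c\<tau> co[OF cont(3) cY] YK)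
  qed
  ultimately obtain v where v: "v \<in> C" "G v = v"
    using schauder[OF C_convex C_nonempty, of G "H ` D \<inter> C"] by blast
  define x where "x = U v"
  note vK = CK[OF v(1)]
  have x: "x \<in> K" and px: "p x = s v * p v" and qx: "q x = s v * q v"
    using sK(1,5,6)[OF v(1)] by (simp_all add: x_def)
  have \<tau>\<theta>: "\<tau> v = \<theta> v" using lG[OF v(1)] v(2) by (simp add: \<tau>_def)
  have px': "p x = (1 - \<tau> v) * \<rho> + \<tau> v * \<sigma> * (p v / q v)"
    and qx': "q x = (1 - \<tau> v) * \<rho> * (q v / p v) + \<tau> v * \<sigma>"
    unfolding px qx s_def using ppos[OF v(1)] by (simp_all add: field_simps)
  have \<tau>0: "0 < \<delta> v" if "\<tau> v = 0"
    using \<rho>(2)[OF x] that px' by (simp add: \<delta>_def P_def flip: x_def)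
  have \<tau>1: "\<delta> v < 0" if "\<tau> v = 1"
    using \<sigma>(2)[OF x] that qx' by (simp add: \<delta>_def P_def flip: x_def)
  \<comment> \<open>At either end of [0,1] the sign of \<open>\<delta> v\<close> would make
    \<open>\<theta> v\<close> differ from \<open>\<tau> v\<close>. Strictly inside, the truncation
    is inactive and \<open>\<theta> v = \<tau> v + \<delta> v\<close>.\<close>
  have \<delta>0: "\<delta> v = 0" and \<tau>01: "0 < \<tau> v" "\<tau> v < 1"
    using \<tau>0 \<tau>1 \<tau>\<theta> \<tau>[OF v(1)] unfolding \<theta>_def by linarith+
  have Yx: "Y v = T x" by (simp add: Y_def \<delta>0 x_def)
  define \<kappa> where "\<kappa> = l (Y v) / (1 + \<theta> v) / s v"
  have \<kappa>: "0 < \<kappa>" using lY[OF v(1)] \<mu> \<theta>01[of v] sK(4)[OF v(1)] by (simp add: \<kappa>_def)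
  have "\<kappa> *\<^sub>R x = (l (Y v) / (1 + \<theta> v)) *\<^sub>R v"
    using sK(4)[OF v(1)] by (simp add: \<kappa>_def x_def U_def)
  also have "\<dots> = (l (Y v) / (1 + \<theta> v)) *\<^sub>R G v" by (simp add: v(2))
  also have "\<dots> = Y v" using lY[OF v(1)] \<mu> \<theta>01(1)[of v] by (simp add: G_def)
  finally have Tx: "T x = \<kappa> *\<^sub>R x" by (simp add: Yx)
  have "P v x = P v (T x)" using \<delta>0 by (simp add: \<delta>_def x_def)
  also have "\<dots> = \<kappa> * P v x"
    using \<kappa> x by (simp add: Tx P_def p_scale q_scale algebra_simps)
  finally have "P v x = \<kappa> * P v x" .
  moreover have "0 < P v x"
    using Pq(1)[OF v(1) x] mult_pos_pos[OF sK(4)[OF v(1)] ppos(2)[OF v(1)]] qx by simp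
  ultimately have "\<kappa> = 1" by simp
  then have "T x = x" using Tx by simp
  moreover have "0 < p x" using ppos[OF v(1)] sK(4)[OF v(1)] px by simp
  moreover
  have pq: "1 \<le> p v / q v" "q v / p v \<le> 1" "c \<le> q v / p v" "p v / q v \<le> 1 / c"
    using ppos[OF v(1)] q_p[OF vK] p_q[OF vK] c by (simp_all add: field_simps)
  \<comment> \<open>As \<open>q v \<le> p v\<close>, \<open>p x\<close> is at least, and
    \<open>q x\<close> at most, the convex combination
    \<open>(1 - \<tau> v) * \<rho> + \<tau> v * \<sigma>\<close>, which lies strictly between \<rho>
    and \<sigma>.\<close>
  have "\<rho> < p x \<and> q x < \<sigma>" if "\<rho> < \<sigma>"
  proof
    have "\<tau> v * \<sigma> * 1 \<le> \<tau> v * \<sigma> * (p v / q v)" "(1 - \<tau> v) * \<rho> * (q v / p v) \<le> (1 - \<tau> v) * \<rho> * 1"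
      using pq \<tau>01 \<rho>(1) \<sigma>(1) by (intro mult_left_mono; simp)+
    moreover have "\<tau> v * \<rho> < \<tau> v * \<sigma>" "(1 - \<tau> v) * \<rho> < (1 - \<tau> v) * \<sigma>" using \<tau>01 that by simp_all
    ultimately show "\<rho> < p x" "q x < \<sigma>" unfolding px' qx' by (simp_all add: algebra_simps)
  qed
  \<comment> \<open>The same formulas are now estimated the other way, through
    \<open>c \<le> q v / p v\<close>; the factor lost is made up by
    \<open>\<sigma> < c * \<rho>\<close>.\<close>
  moreover have "\<sigma> < q x \<and> p x < \<rho>" if "\<sigma> < c * \<rho>"
  proof
    have "\<tau> v * \<sigma> * (p v / q v) \<le> \<tau> v * \<sigma> * (1 / c)" "(1 - \<tau> v) * \<rho> * c \<le> (1 - \<tau> v) * \<rho> * (q v / p v)"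
      using pq \<tau>01 \<rho>(1) \<sigma>(1) by (intro mult_left_mono; simp)+
    moreover have "\<sigma> / c < \<rho>" using that c by (simp add: field_simps)
    then have "\<tau> v * (\<sigma> / c) < \<tau> v * \<rho>" "(1 - \<tau> v) * \<sigma> < (1 - \<tau> v) * (c * \<rho>)"
      using \<tau>01 that by (intro mult_strict_left_mono; simp)+
    ultimately show "\<sigma> < q x" "p x < \<rho>" unfolding px' qx' by (simp_all add: algebra_simps)
  qed
  ultimately show ?thesis using x by blast
qed

section \<open>Hammerstein operators\<close>

text \<open>\<open>clip\<close> extends functions on \<open>[0,1]\<close> constantly, so that bounded continuous functions on
  the real line can stand in for \<open>C[0,1]\<close>.\<close>

definition clip :: "real \<Rightarrow> real" where "clip t = max 0 (min 1 t)"

lemma clip_in [simp]: "clip t \<in> {0..1}" "0 \<le> clip t" "clip t \<le> 1"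
  by (auto simp: clip_def)

lemma clip_id [simp]: "t \<in> {0..1} \<Longrightarrow> clip t = t"
  by (auto simp: clip_def)

lemma continuous_on_clip: "continuous_on A clip"
  unfolding clip_def by (intro continuous_intros)

text \<open>Arzela-Ascoli on [0,1] with one prescribed modulus \<open>D\<close> for the whole
  family. The nonstrict inequalities and the constancy outside [0,1] pass to the limit, so the limit
  stays in the set.\<close>

lemma compact_equicontinuous_bcontfun:
  fixes M :: real and D :: "real \<Rightarrow> real"
  assumes D: "\<And>e. 0 < e \<Longrightarrow> 0 < D e"
  shows "compact {w :: real \<Rightarrow>\<^sub>C real. (\<forall>t. w t = w (clip t)) \<and> (\<forall>t. \<bar>w t\<bar> \<le> M) \<and>
    (\<forall>e>0. \<forall>s\<in>{0..1}. \<forall>t\<in>{0..1}. \<bar>s - t\<bar> < D e \<longrightarrow> \<bar>w s - w t\<bar> \<le> e)}" (is "compact ?S")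
  unfolding compact_def
proof (intro allI impI)
  fix X :: "nat \<Rightarrow> real \<Rightarrow>\<^sub>C real" assume "\<forall>n. X n \<in> ?S"
  then have clip: "\<And>n t. X n t = X n (clip t)" and bound: "\<And>n t. \<bar>X n t\<bar> \<le> M"
    and equi: "\<And>n e s t. 0 < e \<Longrightarrow> s \<in> {0..1} \<Longrightarrow> t \<in> {0..1} \<Longrightarrow> \<bar>s - t\<bar> < D e \<Longrightarrow> \<bar>X n s - X n t\<bar> \<le> e"
    by blast+
  have equi': "\<exists>d>0. \<forall>n y. y \<in> {0..1} \<and> norm (x - y) < d \<longrightarrow> norm (X n x - X n y) < e"
    if x: "x \<in> {0..1}" and e: "0 < e" for x e
  proof -
    have "0 < D (e / 2)" using D e by simp
    moreover have "norm (X n x - X n y) < e" if "y \<in> {0..1}" "norm (x - y) < D (e / 2)" for n y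
      using equi[of "e / 2" x y n] that x e by simp
    ultimately show ?thesis by blast
  qed
  have bound': "norm (X n x) \<le> M" for n x using bound by simp
  obtain g r where r: "strict_mono (r :: nat \<Rightarrow> nat)"
    and g: "\<And>e. 0 < e \<Longrightarrow> \<exists>N. \<forall>n t. n \<ge> N \<and> t \<in> {0..1} \<longrightarrow> norm (X (r n) t - g t) < e"
    using Arzela_Ascoli[of "{0..1::real}" "\<lambda>n. apply_bcontfun (X n)" M, OF compact_Icc bound' equi']
    by metis
  \<comment> \<open>The limit \<open>g\<close> is controlled only on [0,1]; composing with
    \<open>clip\<close> gives the limit on the whole line and keeps the convergence uniform.\<close>
  have unif: "uniform_limit UNIV (\<lambda>n. apply_bcontfun (X (r n))) (\<lambda>t. g (clip t)) sequentially"
    unfolding uniform_limit_sequentially_iff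
  proof (intro allI impI)
    fix e :: real assume "0 < e"
    then obtain N where "\<forall>n t. n \<ge> N \<and> t \<in> {0..1} \<longrightarrow> norm (X (r n) t - g t) < e" using g by blast
    then show "\<exists>N. \<forall>n\<ge>N. \<forall>t\<in>UNIV. dist (X (r n) t) (g (clip t)) < e"
      by (metis clip clip_in(1) dist_norm)
  qed
  then obtain w :: "real \<Rightarrow>\<^sub>C real" where w: "(\<lambda>t. g (clip t)) = apply_bcontfun w" "(\<lambda>n. X (r n)) \<longlonglongrightarrow> w"
    by (rule uniform_limit_bcontfunE) simp
  have lim: "(\<lambda>n. X (r n) t) \<longlonglongrightarrow> w t" for t
    using tendsto_uniform_limitI[OF tendsto_bcontfun_uniform_limit[OF w(2)]] by simp
  have "w t = w (clip t)" for t by (simp flip: w(1))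
  moreover have "\<bar>w t\<bar> \<le> M" for t
    by (rule Lim_bounded[OF tendsto_rabs[OF lim]]) (use bound in auto)
  moreover have "\<bar>w s - w t\<bar> \<le> e" if "0 < e" "s \<in> {0..1}" "t \<in> {0..1}" "\<bar>s - t\<bar> < D e" for e s t
    by (rule Lim_bounded[OF tendsto_rabs[OF tendsto_diff[OF lim lim]]]) (use equi that in auto)
  ultimately have "w \<in> ?S" by blast
  then show "\<exists>l\<in>?S. \<exists>r. strict_mono r \<and> (X \<circ> r) \<longlonglongrightarrow> l"
    using r w(2) by (auto simp: comp_def)
qed

section \<open>Suprema and infima of continuous functions on intervals\<close>

lemma eq_if_same_upper_bounds: "(\<And>M. x \<le> M \<longleftrightarrow> y \<le> M) \<Longrightarrow> x = (y::'a::order)"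
  by (meson order.antisym order_refl)

lemma eq_if_same_lower_bounds: "(\<And>M. M \<le> x \<longleftrightarrow> M \<le> y) \<Longrightarrow> x = (y::'a::order)"
  by (meson order.antisym order_refl)

lemma sup_norm_le_iff:
  assumes "continuous_on {0..1} u"
  shows "sup_norm u \<le> M \<longleftrightarrow> (\<forall>t\<in>{0..1}. \<bar>u t\<bar> \<le> M)"
proof -
  have "compact ((\<lambda>t. \<bar>u t\<bar>) ` {0..1})"
    using assms by (intro compact_continuous_image continuous_intros) auto
  then have "bdd_above ((\<lambda>t. \<bar>u t\<bar>) ` {0..1})"
    by (intro bounded_imp_bdd_above compact_imp_bounded)
  then show ?thesis unfolding sup_norm_def by (intro cSUP_le_iff) auto
qed

lemma le_INF_interval_iff:
  fixes u :: "real \<Rightarrow> real"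
  assumes "continuous_on {a..b} u" "a \<le> b"
  shows "M \<le> (INF t\<in>{a..b}. u t) \<longleftrightarrow> (\<forall>t\<in>{a..b}. M \<le> u t)"
proof -
  have "compact (u ` {a..b})"
    using assms by (intro compact_continuous_image) auto
  then have "bdd_below (u ` {a..b})"
    by (intro bounded_imp_bdd_below compact_imp_bounded)
  then show ?thesis using assms(2) by (intro le_cINF_iff) auto
qed

lemma SUP_interval_upper:
  fixes u :: "real \<Rightarrow> real"
  assumes "continuous_on {a..b} u" "t \<in> {a..b}"
  shows "u t \<le> (SUP t\<in>{a..b}. u t)"
proof -
  have "compact (u ` {a..b})"
    using assms by (intro compact_continuous_image) auto
  then have "bdd_above (u ` {a..b})"
    by (intro bounded_imp_bdd_above compact_imp_bounded)
  then show ?thesis using assms(2) by (intro cSUP_upper)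
qed

lemma INF_interval_lower:
  fixes u :: "real \<Rightarrow> real"
  assumes "continuous_on {a..b} u" "t \<in> {a..b}"
  shows "(INF t\<in>{a..b}. u t) \<le> u t"
  using le_INF_interval_iff[OF assms(1), of "INF t\<in>{a..b}. u t"] assms(2) by auto

lemma continuous_on_if_dist_le:
  fixes g :: "'a::metric_space \<Rightarrow> real"
  assumes "\<And>u v. g u \<le> g v + dist u v"
  shows "continuous_on A g"
proof (rule lipschitz_on_continuous_on)
  have "\<bar>g u - g v\<bar> \<le> dist u v" for u v
    using assms[of u v] assms[of v u] by (simp add: dist_commute abs_le_iff algebra_simps)
  then show "1-lipschitz_on A g"
    by (intro lipschitz_onI) (auto simp: dist_real_def)
qed

section \<open>The cone, its maximum and its minimum functional\<close>

locale hammerstein =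
  fixes f :: "real \<Rightarrow> real" and k :: "real \<Rightarrow> real \<Rightarrow> real"
    and \<Phi> :: "real \<Rightarrow> real" and a b c :: real
  assumes f_cont: "continuous_on {0..} f"
    and f_nonneg: "\<And>x. x \<ge> 0 \<Longrightarrow> f x \<ge> 0"
    and k_cont: "continuous_on ({0..1} \<times> {0..1}) (\<lambda>(t, s). k t s)"
    and k_nonneg: "\<And>t s. t \<in> {0..1} \<Longrightarrow> s \<in> {0..1} \<Longrightarrow> k t s \<ge> 0"
    and Phi_cont: "continuous_on {0..1} \<Phi>"
    and Phi_nonneg: "\<And>s. s \<in> {0..1} \<Longrightarrow> \<Phi> s \<ge> 0"
    and ab: "0 \<le> a" "a \<le> b" "b \<le> 1"
    and c: "0 < c" "c \<le> 1"
    and k_upper: "\<And>t s. t \<in> {0..1} \<Longrightarrow> s \<in> {0..1} \<Longrightarrow> k t s \<le> \<Phi> s"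
    and k_lower: "\<And>t s. t \<in> {a..b} \<Longrightarrow> s \<in> {0..1} \<Longrightarrow> c * \<Phi> s \<le> k t s"
    and Phi_int: "integral {a..b} \<Phi> > 0"
begin

text \<open>Evaluating at \<open>clip t\<close> makes every image of a cone element constant outside
  [0,1]. For \<open>u\<close> in \<open>K\<close> the integral is bounded and continuous in
  \<open>t\<close>, so \<open>Bcontfun\<close> returns the intended function there
  (\<open>T_apply\<close>).\<close>

definition T :: "(real \<Rightarrow>\<^sub>C real) \<Rightarrow> (real \<Rightarrow>\<^sub>C real)" where
  "T u = Bcontfun (\<lambda>t. integral {0..1} (\<lambda>s. k (clip t) s * f (u s)))"

definition p :: "(real \<Rightarrow>\<^sub>C real) \<Rightarrow> real" where "p u = sup_norm u"

definition q :: "(real \<Rightarrow>\<^sub>C real) \<Rightarrow> real" where "q u = (INF t\<in>{a..b}. u t)"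

text \<open>Values outside [0,1] are unrestricted, so \<open>p\<close> is only a seminorm on this
  space. Fixed points of \<open>T\<close> in \<open>K\<close> are still determined by their values
  on [0,1], by \<open>T_clip\<close>.\<close>

definition K :: "(real \<Rightarrow>\<^sub>C real) set" where
  "K = {u. (\<forall>t\<in>{0..1}. 0 \<le> apply_bcontfun u t) \<and> c * p u \<le> q u}"

lemma p_le_iff: "p u \<le> M \<longleftrightarrow> (\<forall>t\<in>{0..1}. \<bar>u t\<bar> \<le> M)" for u :: "real \<Rightarrow>\<^sub>C real"
  unfolding p_def by (rule sup_norm_le_iff) simp

lemma le_q_iff: "M \<le> q u \<longleftrightarrow> (\<forall>t\<in>{a..b}. M \<le> u t)" for u :: "real \<Rightarrow>\<^sub>C real"
  unfolding q_def by (rule le_INF_interval_iff) (use ab in auto)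

lemma K_iff: "u \<in> K \<longleftrightarrow> (\<forall>t\<in>{0..1}. 0 \<le> u t) \<and> c * p u \<le> q u" for u :: "real \<Rightarrow>\<^sub>C real"
  by (simp add: K_def)

lemma p_upper: "t \<in> {0..1} \<Longrightarrow> \<bar>u t\<bar> \<le> p u" for u :: "real \<Rightarrow>\<^sub>C real"
  using p_le_iff[of u "p u"] by auto

lemma q_lower: "t \<in> {a..b} \<Longrightarrow> q u \<le> u t" for u :: "real \<Rightarrow>\<^sub>C real"
  using le_q_iff[of "q u" u] by auto

lemma p_nonneg: "0 \<le> p u" for u :: "real \<Rightarrow>\<^sub>C real"
  using p_upper[of 0 u] by simp

lemma K_nonneg: "u \<in> K \<Longrightarrow> t \<in> {0..1} \<Longrightarrow> 0 \<le> u t" for u :: "real \<Rightarrow>\<^sub>C real"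
  by (simp add: K_def)

lemma ab_subset: "t \<in> {a..b} \<Longrightarrow> t \<in> {0..1}"
  using ab by auto

lemma continuous_on_p: "continuous_on A p"
proof (rule continuous_on_if_dist_le)
  fix u v :: "real \<Rightarrow>\<^sub>C real"
  have "\<bar>u t\<bar> \<le> p v + dist u v" if "t \<in> {0..1}" for t
    using p_upper[OF that, of v] dist_bounded[of u t v] by (simp add: dist_real_def)
  then show "p u \<le> p v + dist u v" by (simp add: p_le_iff)
qed

lemma continuous_on_q: "continuous_on A q"
proof (rule continuous_on_if_dist_le)
  fix u v :: "real \<Rightarrow>\<^sub>C real"
  have "q u - dist u v \<le> v t" if "t \<in> {a..b}" for t
    using q_lower[OF that, of u] dist_bounded[of u t v] by (simp add: dist_real_def)
  then have "q u - dist u v \<le> q v" by (simp add: le_q_iff)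
  then show "q u \<le> q v + dist u v" by simp
qed

lemma continuous_on_eval: "continuous_on A (\<lambda>u :: real \<Rightarrow>\<^sub>C real. u t)"
proof (rule continuous_on_if_dist_le)
  fix u v :: "real \<Rightarrow>\<^sub>C real"
  show "u t \<le> v t + dist u v" using dist_bounded[of u t v] by (simp add: dist_real_def)
qed

lemma p_scale: "0 \<le> r \<Longrightarrow> p (r *\<^sub>R u) = r * p u" for u :: "real \<Rightarrow>\<^sub>C real"
proof (cases "r = 0")
  case True
  have "p 0 \<le> 0" by (simp add: p_le_iff)
  then show ?thesis using True p_nonneg[of 0] by simp
next
  case False
  assume "0 \<le> r"
  then have "0 < r" using False by simp
  show ?thesis
  proof (rule eq_if_same_upper_bounds)
    fix M
    have "r * p u \<le> M \<longleftrightarrow> p u \<le> M / r" using \<open>0 < r\<close> by (simp add: field_simps)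
    then show "p (r *\<^sub>R u) \<le> M \<longleftrightarrow> r * p u \<le> M"
      using \<open>0 < r\<close> by (simp add: p_le_iff abs_mult field_simps)
  qed
qed

lemma q_scale: "0 \<le> r \<Longrightarrow> q (r *\<^sub>R u) = r * q u" for u :: "real \<Rightarrow>\<^sub>C real"
proof (cases "r = 0")
  case True
  then show ?thesis using ab by (simp add: q_def)
next
  case False
  assume "0 \<le> r"
  then have "0 < r" using False by simp
  show ?thesis
  proof (rule eq_if_same_lower_bounds)
    fix M
    have "M \<le> r * q u \<longleftrightarrow> M / r \<le> q u" using \<open>0 < r\<close> by (simp add: field_simps)
    then show "M \<le> q (r *\<^sub>R u) \<longleftrightarrow> M \<le> r * q u"
      using \<open>0 < r\<close> by (simp add: le_q_iff field_simps)
  qed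
qed

lemma p_shift: "u \<in> K \<Longrightarrow> 0 \<le> r \<Longrightarrow> p (u + r *\<^sub>R const_bcontfun 1) = p u + r" for u :: "real \<Rightarrow>\<^sub>C real"
proof (rule eq_if_same_upper_bounds)
  fix M assume u: "u \<in> K" and r: "0 \<le> r"
  have "p u + r \<le> M \<longleftrightarrow> p u \<le> M - r" by auto
  then show "p (u + r *\<^sub>R const_bcontfun 1) \<le> M \<longleftrightarrow> p u + r \<le> M"
    unfolding p_le_iff using K_nonneg[OF u] r by (fastforce simp: abs_if)
qed

lemma q_shift: "q (u + r *\<^sub>R const_bcontfun 1) = q u + r" for u :: "real \<Rightarrow>\<^sub>C real"
proof (rule eq_if_same_lower_bounds)
  fix M
  have "M \<le> q u + r \<longleftrightarrow> M - r \<le> q u" by auto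
  then show "M \<le> q (u + r *\<^sub>R const_bcontfun 1) \<longleftrightarrow> M \<le> q u + r"
    unfolding le_q_iff by (auto simp: algebra_simps)
qed

lemma K_add: assumes u: "u \<in> K" and v: "v \<in> K" shows "u + v \<in> K"
  unfolding K_iff
proof
  have "p (u + v) \<le> p u + p v"
    unfolding p_le_iff using p_upper by (auto intro!: order_trans[OF abs_triangle_ineq] add_mono)
  then have "c * p (u + v) \<le> c * p u + c * p v" using c by (simp flip: distrib_left)
  also have "\<dots> \<le> q u + q v" using u v by (simp add: K_iff)
  also have "\<dots> \<le> q (u + v)"
    unfolding le_q_iff using q_lower by (auto intro!: add_mono)
  finally show "c * p (u + v) \<le> q (u + v)" .
qed (use u v in \<open>auto simp: K_iff\<close>)

lemma K_scale: "0 \<le> r \<Longrightarrow> u \<in> K \<Longrightarrow> r *\<^sub>R u \<in> K"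
  by (auto simp: K_iff p_scale q_scale mult.left_commute[of c] intro: mult_left_mono)

lemma one_in_K: "const_bcontfun 1 \<in> K"
proof -
  have "p (const_bcontfun 1) \<le> 1" "1 \<le> q (const_bcontfun 1)" by (auto simp: p_le_iff le_q_iff)
  then have "c * p (const_bcontfun 1) \<le> q (const_bcontfun 1)"
    using c p_nonneg[of "const_bcontfun 1"] mult_mono[of c 1 "p (const_bcontfun 1)" 1] by simp
  then show ?thesis by (simp add: K_iff)
qed

lemma closed_K: "closed K"
proof -
  have "closed {u :: real \<Rightarrow>\<^sub>C real. 0 \<le> apply_bcontfun u t}" for t
    by (rule closed_Collect_le[OF continuous_on_const continuous_on_eval])
  moreover have "closed {u. c * p u \<le> q u}"
    by (rule closed_Collect_le[OF continuous_on_mult_left[OF continuous_on_p] continuous_on_q])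
  ultimately have "closed ((\<Inter>t\<in>{0..1}. {u. 0 \<le> apply_bcontfun u t}) \<inter> {u. c * p u \<le> q u})"
    by (intro closed_Int closed_INT ballI)
  also have "(\<Inter>t\<in>{0..1}. {u. 0 \<le> apply_bcontfun u t}) \<inter> {u. c * p u \<le> q u} = K"
    by (auto simp: K_iff)
  finally show ?thesis .
qed

section \<open>The integral operator: invariance of the cone, continuity, compactness\<close>

lemma k_cont_on: "continuous_on {0..1} (k t)" if "t \<in> {0..1}"
proof -
  have "continuous_on {0..1} (\<lambda>s. (\<lambda>(t, s). k t s) (t, s))"
    by (rule continuous_on_compose2[OF k_cont]) (use that in \<open>auto intro!: continuous_intros\<close>)
  then show ?thesis by simp
qed

lemma fu_cont: "continuous_on {0..1} (\<lambda>s. f (u s))" if "u \<in> K" for u :: "real \<Rightarrow>\<^sub>C real"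
  by (rule continuous_on_compose2[OF f_cont]) (use K_nonneg[OF that] in auto)

lemma kfu_cont: "continuous_on {0..1} (\<lambda>s. k t s * f (u s))" if "u \<in> K" "t \<in> {0..1}"
  for u :: "real \<Rightarrow>\<^sub>C real"
  using k_cont_on fu_cont that by (intro continuous_intros) auto

lemma fu_nonneg: "0 \<le> f (u s)" if "u \<in> K" "s \<in> {0..1}" for u :: "real \<Rightarrow>\<^sub>C real"
  using f_nonneg K_nonneg that by blast

lemma k_bounded: obtains B where "0 < B" "\<And>t s. t \<in> {0..1} \<Longrightarrow> s \<in> {0..1} \<Longrightarrow> k t s \<le> B"
proof -
  have "compact ((\<lambda>(t, s). k t s) ` ({0..1} \<times> {0..1}))"
    using k_cont by (intro compact_continuous_image compact_Times) auto
  then obtain B where "\<And>z. z \<in> (\<lambda>(t, s). k t s) ` ({0..1} \<times> {0..1}) \<Longrightarrow> norm z \<le> B" "0 < B"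
    by (meson compact_imp_bounded bounded_pos)
  then have "k t s \<le> B" if "t \<in> {0..1}" "s \<in> {0..1}" for t s
    using that by (metis (mono_tags, lifting) SigmaI abs_le_D1 case_prod_conv image_eqI real_norm_def)
  then show ?thesis using \<open>0 < B\<close> that by blast
qed

lemma continuous_on_integral_k:
  assumes "continuous_on {x..y} g" "{x..y} \<subseteq> {0..1}"
  shows "continuous_on {0..1} (\<lambda>t. integral {x..y} (\<lambda>s. k t s * g s))"
proof -
  have "continuous_on ({0..1} \<times> cbox x y) (\<lambda>z. (\<lambda>(t, s). k t s) z * g (snd z))"
    using assms by (intro continuous_intros continuous_on_subset[OF k_cont] continuous_on_compose2[OF assms(1)])
      (auto simp: subset_iff)
  then have "continuous_on {0..1} (\<lambda>t. integral (cbox x y) (\<lambda>s. k t s * g s))"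
    by (intro integral_continuous_on_param) (simp add: case_prod_beta)
  then show ?thesis by simp
qed

lemma T_apply: "T u t = integral {0..1} (\<lambda>s. k (clip t) s * f (u s))" if u: "u \<in> K"
  for u :: "real \<Rightarrow>\<^sub>C real"
proof -
  define h where "h t = integral {0..1} (\<lambda>s. k t s * f (u s))" for t
  have h: "continuous_on {0..1} h"
    unfolding h_def by (rule continuous_on_integral_k[OF fu_cont[OF u]]) simp
  have "continuous_on UNIV (\<lambda>t. h (clip t))"
    by (rule continuous_on_compose2[OF h continuous_on_clip]) auto
  moreover have "bounded (range (\<lambda>t. h (clip t)))"
    by (rule bounded_subset[OF compact_imp_bounded[OF compact_continuous_image[OF h]]]) auto
  ultimately have "(\<lambda>t. h (clip t)) \<in> bcontfun" by (simp add: bcontfun_def)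
  then show ?thesis by (simp add: T_def Bcontfun_inverse h_def)
qed

lemma T_clip: "T u t = T u (clip t)" if "u \<in> K" for u :: "real \<Rightarrow>\<^sub>C real"
  using that by (simp add: T_apply)

lemma T_apply_in: "T u t = integral {0..1} (\<lambda>s. k t s * f (u s))" if "u \<in> K" "t \<in> {0..1}"
  for u :: "real \<Rightarrow>\<^sub>C real"
  using that by (simp add: T_apply)

text \<open>The single number \<open>J\<close>, the integral of \<open>\<Phi> s * f (u s)\<close>,
  bounds \<open>T u\<close> from above on [0,1], and \<open>c * J\<close> bounds it from below on
  [a,b].\<close>

lemma T_in_K: assumes u: "u \<in> K" shows "T u \<in> K"
proof -
  have pos: "0 \<le> T u t" if "t \<in> {0..1}" for t
    unfolding T_apply_in[OF u that]
    by (rule integral_nonneg) (use kfu_cont[OF u that] k_nonneg that fu_nonneg[OF u] in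
      \<open>auto intro!: integrable_continuous_real mult_nonneg_nonneg\<close>)
  define J where "J = integral {0..1} (\<lambda>s. \<Phi> s * f (u s))"
  have Phi_f: "(\<lambda>s. \<Phi> s * f (u s)) integrable_on {0..1}"
    by (intro integrable_continuous_real continuous_intros Phi_cont fu_cont u)
  have "p (T u) \<le> J"
    unfolding p_le_iff
  proof
    fix t :: real assume t: "t \<in> {0..1}"
    have "T u t \<le> J" unfolding T_apply_in[OF u t] J_def
      by (rule integral_le) (use kfu_cont[OF u t] Phi_f k_upper t fu_nonneg[OF u] in
        \<open>auto intro!: integrable_continuous_real mult_right_mono\<close>)
    then show "\<bar>T u t\<bar> \<le> J" using pos[OF t] by simp
  qed
  moreover have "c * J \<le> q (T u)"
    unfolding le_q_iff
  proof
    fix t assume t: "t \<in> {a..b}"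
    have "c * J = integral {0..1} (\<lambda>s. c * (\<Phi> s * f (u s)))" by (simp add: J_def)
    also have "\<dots> \<le> T u t" unfolding T_apply_in[OF u ab_subset[OF t]]
    proof (rule integral_le)
      show "(\<lambda>s. c * (\<Phi> s * f (u s))) integrable_on {0..1}" using integrable_on_cmult_left[OF Phi_f] by simp
      show "(\<lambda>s. k t s * f (u s)) integrable_on {0..1}"
        using kfu_cont[OF u ab_subset[OF t]] by (rule integrable_continuous_real)
      show "c * (\<Phi> s * f (u s)) \<le> k t s * f (u s)" if "s \<in> {0..1}" for s
        using mult_right_mono[OF k_lower[OF t that] fu_nonneg[OF u that]] by (simp add: mult.assoc)
    qed
    finally show "c * J \<le> T u t" .
  qed
  ultimately have "c * p (T u) \<le> q (T u)" using c by (meson mult_left_mono less_imp_le order_trans)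
  then show ?thesis using pos by (simp add: K_iff)
qed

lemma f_bounded: obtains M where "0 < M" "\<And>x. 0 \<le> x \<Longrightarrow> x \<le> R \<Longrightarrow> f x \<le> M"
proof -
  have "compact (f ` {0..R})"
    by (intro compact_continuous_image continuous_on_subset[OF f_cont]) auto
  then obtain M where M: "0 < M" "\<And>y. y \<in> f ` {0..R} \<Longrightarrow> norm y \<le> M"
    by (meson compact_imp_bounded bounded_pos)
  have "f x \<le> M" if "0 \<le> x" "x \<le> R" for x using M(2)[of "f x"] that by auto
  then show ?thesis using M(1) that by blast
qed

lemma T_continuous: "continuous_on K T"
  unfolding continuous_on_iff
proof (intro ballI allI impI)
  fix u and \<epsilon> :: real assume u: "u \<in> K" and \<epsilon>: "0 < \<epsilon>"
  obtain B where B: "0 < B" "\<And>t s. t \<in> {0..1} \<Longrightarrow> s \<in> {0..1} \<Longrightarrow> k t s \<le> B" using k_bounded by blast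
  \<comment> \<open>Every \<open>v\<close> in \<open>K\<close> within distance 1 of \<open>u\<close>
    has its values on [0,1] in \<open>{0..R}\<close>, where \<open>f\<close> is uniformly
    continuous.\<close>
  define R where "R = p u + 1"
  have "uniformly_continuous_on {0..R} f"
    by (intro compact_uniformly_continuous continuous_on_subset[OF f_cont]) auto
  moreover have "0 < \<epsilon> / (2 * B)" using \<epsilon> B(1) by simp
  ultimately obtain d where d: "0 < d" and
    df: "\<And>x y. x \<in> {0..R} \<Longrightarrow> y \<in> {0..R} \<Longrightarrow> dist y x < d \<Longrightarrow> dist (f y) (f x) < \<epsilon> / (2 * B)"
    unfolding uniformly_continuous_on_def by blast
  have "dist (T v) (T u) < \<epsilon>" if v: "v \<in> K" and vu: "dist v u < min d 1" for v
  proof -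
    have "dist (T v t) (T u t) \<le> \<epsilon> / 2" for t
    proof -
      let ?t = "clip t"
      have "T v t - T u t = integral {0..1} (\<lambda>s. k ?t s * f (v s) - k ?t s * f (u s))"
        unfolding T_apply[OF u] T_apply[OF v]
        by (rule integral_diff[symmetric]; rule integrable_continuous_real; rule kfu_cont) (auto simp: u v)
      also have "norm \<dots> \<le> \<epsilon> / 2 * (1 - 0)"
      proof (rule integral_bound)
        show "continuous_on {0..1} (\<lambda>s. k ?t s * f (v s) - k ?t s * f (u s))"
          by (intro continuous_on_diff kfu_cont u v) auto
        show "norm (k ?t s * f (v s) - k ?t s * f (u s)) \<le> \<epsilon> / 2" if s: "s \<in> {0..1}" for s
        proof -
          have vs: "dist (v s) (u s) < min d 1" using vu by (rule dist_fun_lt_imp_dist_val_lt)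
          have "v s \<in> {0..R}" "u s \<in> {0..R}"
            using vs p_upper[OF s, of u] K_nonneg[OF u s] K_nonneg[OF v s] by (auto simp: R_def dist_real_def)
          then have "\<bar>f (v s) - f (u s)\<bar> \<le> \<epsilon> / (2 * B)"
            using df[of "u s" "v s"] vs by (simp add: dist_real_def)
          then have "k ?t s * \<bar>f (v s) - f (u s)\<bar> \<le> B * (\<epsilon> / (2 * B))"
            using B k_nonneg s by (intro mult_mono) auto
          then show ?thesis using B(1) k_nonneg[of ?t s] s
            by (simp add: abs_mult flip: right_diff_distrib)
        qed
      qed simp
      finally show ?thesis by (simp add: dist_norm)
    qed
    then have "dist (T v) (T u) \<le> \<epsilon> / 2" by (rule dist_bound)
    then show ?thesis using \<epsilon> by simp
  qed
  then show "\<exists>d>0. \<forall>v\<in>K. dist v u < d \<longrightarrow> dist (T v) (T u) < \<epsilon>"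
    using d by (intro exI[of _ "min d 1"]) auto
qed

text \<open>A bound on \<open>p u\<close> suffices because \<open>T\<close> reads \<open>u\<close>
  only on [0,1]. It bounds \<open>f (u s)\<close> by \<open>M\<close>, and the uniform continuity of
  \<open>k\<close> then gives all images a common bound and a common modulus of continuity.\<close>

lemma T_compact: "\<exists>S. compact S \<and> S \<subseteq> K \<and> T ` {u \<in> K. p u \<le> R} \<subseteq> S"
proof -
  obtain B where B: "0 < B" "\<And>t s. t \<in> {0..1} \<Longrightarrow> s \<in> {0..1} \<Longrightarrow> k t s \<le> B" using k_bounded by blast
  obtain M where M: "0 < M" "\<And>x. 0 \<le> x \<Longrightarrow> x \<le> R \<Longrightarrow> f x \<le> M" using f_bounded by blast
  \<comment> \<open>The tolerance \<open>e / M\<close> becomes \<open>e\<close> after multiplication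
    by \<open>f (u s) \<le> M\<close>. The condition \<open>0 < e\<close> stands inside the
    existential so that one function \<open>D\<close> can be chosen for all
    \<open>e\<close>.\<close>
  have "\<forall>e. \<exists>d. 0 < e \<longrightarrow> 0 < d \<and> (\<forall>x\<in>{0..1}. \<forall>t\<in>{0..1}. \<forall>s\<in>{0..1}. \<bar>x - t\<bar> < d \<longrightarrow> \<bar>k x s - k t s\<bar> < e / M)"
  proof (intro allI)
    fix e :: real
    have "uniformly_continuous_on ({0..1} \<times> {0..1}) (\<lambda>(t, s). k t s)"
      by (intro compact_uniformly_continuous k_cont compact_Times) auto
    then have "\<exists>d>0. \<forall>z\<in>{0..1} \<times> {0..1}. \<forall>y\<in>{0..1} \<times> {0..1}. dist y z < d \<longrightarrow>
        dist ((\<lambda>(t, s). k t s) y) ((\<lambda>(t, s). k t s) z) < e / M" if "0 < e"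
      using that M(1) unfolding uniformly_continuous_on_def by simp
    then show "\<exists>d. 0 < e \<longrightarrow> 0 < d \<and> (\<forall>x\<in>{0..1}. \<forall>t\<in>{0..1}. \<forall>s\<in>{0..1}. \<bar>x - t\<bar> < d \<longrightarrow> \<bar>k x s - k t s\<bar> < e / M)"
      by (fastforce simp: dist_Pair_Pair dist_real_def)
  qed
  from choice[OF this] obtain D where D: "\<And>e. 0 < e \<Longrightarrow> 0 < D e" and
    Dk: "\<And>e x t s. 0 < e \<Longrightarrow> x \<in> {0..1} \<Longrightarrow> t \<in> {0..1} \<Longrightarrow> s \<in> {0..1} \<Longrightarrow> \<bar>x - t\<bar> < D e \<Longrightarrow> \<bar>k x s - k t s\<bar> < e / M"
    by blast
  define E where "E = {w :: real \<Rightarrow>\<^sub>C real. (\<forall>t. w t = w (clip t)) \<and> (\<forall>t. \<bar>w t\<bar> \<le> B * M) \<and>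
    (\<forall>e>0. \<forall>s\<in>{0..1}. \<forall>t\<in>{0..1}. \<bar>s - t\<bar> < D e \<longrightarrow> \<bar>w s - w t\<bar> \<le> e)}"
  have "compact E" unfolding E_def by (rule compact_equicontinuous_bcontfun[OF D])
  then have "compact (E \<inter> K)" using closed_K by (rule compact_Int_closed)
  moreover have "T u \<in> E \<inter> K" if u: "u \<in> K" and uR: "p u \<le> R" for u
  proof
    have fM: "f (u s) \<le> M" if "s \<in> {0..1}" for s
      using M(2) K_nonneg[OF u that] p_upper[OF that, of u] uR by simp
    have "\<bar>T u t\<bar> \<le> B * M" for t
    proof -
      have "norm (integral {0..1} (\<lambda>s. k (clip t) s * f (u s))) \<le> B * M * (1 - 0)"
      proof (rule integral_bound)
        show "continuous_on {0..1} (\<lambda>s. k (clip t) s * f (u s))" by (rule kfu_cont[OF u]) simp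
        show "norm (k (clip t) s * f (u s)) \<le> B * M" if s: "s \<in> {0..1}" for s
        proof -
          have "k (clip t) s * f (u s) \<le> B * M"
            using B fM[OF s] k_nonneg fu_nonneg[OF u s] s by (intro mult_mono) auto
          then show ?thesis using k_nonneg[of "clip t" s] fu_nonneg[OF u s] s by simp
        qed
      qed simp
      then show ?thesis by (simp add: T_apply[OF u])
    qed
    moreover have "\<bar>T u x - T u t\<bar> \<le> e"
      if e: "0 < e" and x: "x \<in> {0..1}" and t: "t \<in> {0..1}" and xt: "\<bar>x - t\<bar> < D e" for e x t
    proof -
      have "T u x - T u t = integral {0..1} (\<lambda>s. k x s * f (u s) - k t s * f (u s))"
        unfolding T_apply_in[OF u x] T_apply_in[OF u t]
        by (rule integral_diff[symmetric]; rule integrable_continuous_real; rule kfu_cont) (rule u x t)+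
      also have "norm \<dots> \<le> e * (1 - 0)"
      proof (rule integral_bound)
        show "continuous_on {0..1} (\<lambda>s. k x s * f (u s) - k t s * f (u s))"
          by (intro continuous_on_diff kfu_cont u x t)
        show "norm (k x s * f (u s) - k t s * f (u s)) \<le> e" if s: "s \<in> {0..1}" for s
        proof -
          have "\<bar>k x s - k t s\<bar> * f (u s) \<le> e / M * M"
            using Dk[OF e x t s xt] fM[OF s] fu_nonneg[OF u s] e M(1) by (intro mult_mono) auto
          then show ?thesis using M(1) fu_nonneg[OF u s] by (simp add: abs_mult flip: left_diff_distrib)
        qed
      qed simp
      finally show ?thesis by simp
    qed
    ultimately show "T u \<in> E" using T_clip[OF u] by (auto simp: E_def)
  qed (use T_in_K u in auto)
  ultimately show ?thesis by (intro exI[of _ "E \<inter> K"]) auto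
qed

section \<open>Strict inequalities from the two growth conditions\<close>

text \<open>Together with \<open>integral_k_lower\<close> this makes the integrals behind both
  constants positive; it is applied with [0,1] for \<open>m_const\<close> and with [a,b] for
  \<open>M_const\<close>.\<close>

lemma integral_Phi_pos: "0 < integral {x..y} (\<lambda>s. c * \<Phi> s)" if "x \<le> a" "b \<le> y" "0 \<le> x" "y \<le> 1"
proof -
  have int: "\<Phi> integrable_on {x'..y'}" if "0 \<le> x'" "y' \<le> 1" for x' y'
    using that by (intro integrable_continuous_real continuous_on_subset[OF Phi_cont]) auto
  have "integral {a..b} \<Phi> \<le> integral {x..y} \<Phi>"
    using that ab Phi_nonneg int by (intro integral_subset_le) auto
  then show ?thesis using c Phi_int by simp
qed

lemma integral_k_lower:
  assumes "x \<le> a" "b \<le> y" "0 \<le> x" "y \<le> 1" "t \<in> {a..b}"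
  shows "integral {x..y} (\<lambda>s. c * \<Phi> s) \<le> integral {x..y} (k t)"
proof (rule integral_le)
  show "(\<lambda>s. c * \<Phi> s) integrable_on {x..y}"
    using assms by (intro integrable_continuous_real continuous_intros continuous_on_subset[OF Phi_cont]) auto
  show "k t integrable_on {x..y}"
    using assms by (intro integrable_continuous_real continuous_on_subset[OF k_cont_on[OF ab_subset]]) auto
qed (use k_lower assms in auto)

lemma continuous_on_integral_k1:
  assumes "{x..y} \<subseteq> {0..1}" shows "continuous_on {0..1} (\<lambda>t. integral {x..y} (k t))"
  using continuous_on_integral_k[of x y "\<lambda>_. 1"] assms by simp

text \<open>On [0,1] the values of \<open>u\<close> lie in \<open>{0..\<rho>}\<close>, so
  \<open>f (u s)\<close> can be replaced by its strict bound from \<open>cond_I1\<close>; what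
  remains is the integral of \<open>k\<close>, at most \<open>L = 1 / m_const k\<close>.\<close>

lemma p_T_less:
  assumes I1: "cond_I1 f k \<rho>" and \<rho>: "0 < \<rho>" and u: "u \<in> K" and pu: "p u = \<rho>"
  shows "p (T u) < \<rho>"
proof -
  define L where "L = (SUP t\<in>{0..1}. integral {0..1} (k t))"
  have kL: "integral {0..1} (k t) \<le> L" if "t \<in> {0..1}" for t
    unfolding L_def using continuous_on_integral_k1 that by (intro SUP_interval_upper) auto
  \<comment> \<open>The point \<open>t = a\<close> witnesses positivity. It rules out the default
    value \<open>1 / 0 = 0\<close> and lets \<open>M < 1 / L\<close> be multiplied out.\<close>
  have L: "0 < L"
    using integral_Phi_pos[of 0 1] integral_k_lower[of 0 1 a] kL[of a] ab by simp
  define M where "M = (SUP x\<in>{0..\<rho>}. f x / \<rho>)"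
  have fM: "f x \<le> M * \<rho>" if "0 \<le> x" "x \<le> \<rho>" for x
  proof -
    have "f x / \<rho> \<le> M" unfolding M_def using that \<rho>
      by (intro SUP_interval_upper continuous_intros continuous_on_subset[OF f_cont]) auto
    then show ?thesis using \<rho> by (simp add: field_simps)
  qed
  have M0: "0 \<le> M * \<rho>" using fM[of 0] f_nonneg[of 0] \<rho> by simp
  have "M < 1 / L" using I1 by (simp add: cond_I1_def m_const_def M_def L_def)
  then have gap: "M * L < 1" using L by (simp add: field_simps)
  have "\<bar>T u t\<bar> \<le> M * \<rho> * L" if t: "t \<in> {0..1}" for t
  proof -
    have "T u t \<le> integral {0..1} (\<lambda>s. M * \<rho> * k t s)"
      unfolding T_apply_in[OF u t]
    proof (rule integral_le)
      show "k t s * f (u s) \<le> M * \<rho> * k t s" if s: "s \<in> {0..1}" for s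
        using mult_left_mono[OF fM[of "u s"] k_nonneg[OF t s]] K_nonneg[OF u s] p_upper[OF s, of u] pu
        by (simp add: mult.commute)
    qed (use k_cont_on[OF t] kfu_cont[OF u t] in
        \<open>auto intro!: integrable_continuous_real continuous_intros\<close>)
    also have "\<dots> = M * \<rho> * integral {0..1} (k t)" by simp
    also have "\<dots> \<le> M * \<rho> * L" using kL[OF t] M0 by (rule mult_left_mono)
    finally show ?thesis using K_nonneg[OF T_in_K[OF u] t] by simp
  qed
  then have "p (T u) \<le> M * L * \<rho>" by (simp add: p_le_iff mult_ac)
  also have "\<dots> < 1 * \<rho>" using gap \<rho> by (intro mult_strict_right_mono)
  finally show ?thesis by simp
qed

text \<open>For \<open>u\<close> in the cone, \<open>q u = \<sigma>\<close> confines
  \<open>u\<close> on [a,b] to \<open>{\<sigma>..\<sigma> / c}\<close>, the range in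
  \<open>cond_I0\<close>. Only the part of the integral over [a,b] is kept; the rest is
  nonnegative.\<close>

lemma q_T_greater:
  assumes I0: "cond_I0 f k a b c \<sigma>" and \<sigma>: "0 < \<sigma>" and u: "u \<in> K" and qu: "q u = \<sigma>"
  shows "\<sigma> < q (T u)"
proof -
  define L where "L = (INF t\<in>{a..b}. integral {a..b} (k t))"
  have ck: "continuous_on {a..b} (\<lambda>t. integral {a..b} (k t))"
    using ab by (intro continuous_on_subset[OF continuous_on_integral_k1]) auto
  have kL: "L \<le> integral {a..b} (k t)" if "t \<in> {a..b}" for t
    unfolding L_def using ck that by (rule INF_interval_lower)
  have "integral {a..b} (\<lambda>s. c * \<Phi> s) \<le> L"
    unfolding L_def using le_INF_interval_iff[OF ck] integral_k_lower[of a b] ab by simp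
  then have L: "0 < L" using integral_Phi_pos[of a b] ab by simp
  \<comment> \<open>\<open>M\<close> is the infimum in \<open>cond_I0\<close>; the constant
    \<open>M_const k a b\<close> is \<open>1 / L\<close>.\<close>
  define M where "M = (INF x\<in>{\<sigma>..\<sigma> / c}. f x / \<sigma>)"
  have fM: "M * \<sigma> \<le> f x" if "\<sigma> \<le> x" "x \<le> \<sigma> / c" for x
  proof -
    have "M \<le> f x / \<sigma>" unfolding M_def using that \<sigma>
      by (intro INF_interval_lower continuous_intros continuous_on_subset[OF f_cont]) auto
    then show ?thesis using \<sigma> by (simp add: field_simps)
  qed
  have M1: "1 / L < M" using I0 by (simp add: cond_I0_def M_const_def M_def L_def)
  then have gap: "1 < M * L" using L by (simp add: field_simps)
  have "0 < M" using less_trans[OF _ M1] L by simp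
  then have M0: "0 \<le> M * \<sigma>" using \<sigma> by simp
  have "M * L * \<sigma> \<le> T u t" if t: "t \<in> {a..b}" for t
  proof -
    note t' = ab_subset[OF t]
    have cab: "continuous_on {a..b} (k t)" "continuous_on {a..b} (\<lambda>s. k t s * f (u s))"
      using k_cont_on[OF t'] kfu_cont[OF u t'] ab by (auto elim: continuous_on_subset)
    have "M * L * \<sigma> \<le> M * \<sigma> * integral {a..b} (k t)"
      using mult_left_mono[OF kL[OF t] M0] by (simp add: mult_ac)
    also have "\<dots> = integral {a..b} (\<lambda>s. M * \<sigma> * k t s)" by simp
    also have "\<dots> \<le> integral {a..b} (\<lambda>s. k t s * f (u s))"
    proof (rule integral_le)
      show "M * \<sigma> * k t s \<le> k t s * f (u s)" if s: "s \<in> {a..b}" for s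
      proof -
        have "c * u s \<le> c * p u" using p_upper[OF ab_subset[OF s], of u] c by (intro mult_left_mono) auto
        then have "c * u s \<le> \<sigma>" using u qu by (simp add: K_iff)
        then have "u s \<le> \<sigma> / c" using c by (simp add: field_simps)
        then show ?thesis
          using mult_left_mono[OF fM[of "u s"] k_nonneg[OF t' ab_subset[OF s]]] q_lower[OF s, of u] qu
          by (simp add: mult.commute)
      qed
    qed (use cab in \<open>auto intro!: integrable_continuous_real continuous_intros\<close>)
    also have "\<dots> \<le> T u t"
      unfolding T_apply_in[OF u t']
      using ab cab kfu_cont[OF u t'] k_nonneg[OF t'] fu_nonneg[OF u]
      by (intro integral_subset_le) (auto intro!: integrable_continuous_real)
    finally show ?thesis .
  qed
  then have "M * L * \<sigma> \<le> q (T u)" by (simp add: le_q_iff)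
  moreover have "1 * \<sigma> < M * L * \<sigma>" using gap \<sigma> by (intro mult_strict_right_mono)
  ultimately show ?thesis by simp
qed

section \<open>From fixed points to positive solutions\<close>

text \<open>Restricting replaces the values outside [0,1] by \<open>undefined\<close>, the normal
  form of \<open>C01\<close>. Norm, minimum and equation see only [0,1], so the location of the
  fixed point carries over.\<close>

lemma restrict_positive_solution:
  assumes u: "u \<in> K" "T u = u" "0 < p u"
  shows "restrict u {0..1} \<in> positive_solutions f k a b c"
    and "sup_norm (restrict u {0..1}) = p u" and "(INF t\<in>{a..b}. restrict u {0..1} t) = q u"
proof -
  show pu: "sup_norm (restrict u {0..1}) = p u" by (simp add: sup_norm_def p_def)
  show qu: "(INF t\<in>{a..b}. restrict u {0..1} t) = q u"
    unfolding q_def by (rule INF_cong) (use ab_subset in auto)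
  have "continuous_on {0..1} (restrict u {0..1})"
    by (rule continuous_on_eq[OF continuous_on_apply_bcontfun]) simp
  moreover have "u t = integral {0..1} (\<lambda>s. k t s * f (restrict u {0..1} s))" if t: "t \<in> {0..1}" for t
  proof -
    have "u t = integral {0..1} (\<lambda>s. k t s * f (u s))" using T_apply_in[OF u(1) t] u(2) by simp
    also have "\<dots> = integral {0..1} (\<lambda>s. k t s * f (restrict u {0..1} s))"
      by (rule integral_cong) simp
    finally show ?thesis .
  qed
  ultimately show "restrict u {0..1} \<in> positive_solutions f k a b c"
    unfolding positive_solutions_def cone_def C01_def mem_Collect_eq pu qu using u by (simp add: K_iff)
qed

text \<open>The abstract fixed point lemma with the constant function 1 as \<open>e\<close> and
  evaluation at \<open>a\<close> as \<open>l\<close>: this is linear and lies between the minimum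
  over [a,b] and the norm.\<close>

lemma solution_between:
  assumes I1: "cond_I1 f k \<rho>" "0 < \<rho>" and I0: "cond_I0 f k a b c \<sigma>" "0 < \<sigma>"
  shows "\<exists>w\<in>positive_solutions f k a b c.
    (\<rho> < \<sigma> \<longrightarrow> \<rho> < sup_norm w \<and> (INF t\<in>{a..b}. w t) < \<sigma>) \<and>
    (\<sigma> / c < \<rho> \<longrightarrow> \<sigma> < (INF t\<in>{a..b}. w t) \<and> sup_norm w < \<rho>)"
proof -
  have "\<exists>u\<in>K. T u = u \<and> 0 < p u \<and> (\<rho> < \<sigma> \<longrightarrow> \<rho> < p u \<and> q u < \<sigma>) \<and>
    (\<sigma> < c * \<rho> \<longrightarrow> \<sigma> < q u \<and> p u < \<rho>)"
  proof (rule cone_fixed_point_between[where e = "const_bcontfun 1" and l = "\<lambda>u. u a"])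
    show "q u \<le> u a" for u :: "real \<Rightarrow>\<^sub>C real" using q_lower[of a u] ab by simp
    show "u a \<le> p u" for u :: "real \<Rightarrow>\<^sub>C real" using p_upper[of a u] ab by simp
    show "u \<in> K \<Longrightarrow> c * p u \<le> q u" for u :: "real \<Rightarrow>\<^sub>C real" by (simp add: K_iff)
  qed (use K_add K_scale one_in_K continuous_on_p continuous_on_q continuous_on_eval p_scale q_scale
      p_shift q_shift c p_nonneg T_in_K T_continuous T_compact closed_K I1 I0 p_T_less q_T_greater
      in auto)
  then obtain u where u: "u \<in> K" "T u = u" "0 < p u" and
    lt: "\<rho> < \<sigma> \<Longrightarrow> \<rho> < p u \<and> q u < \<sigma>" "\<sigma> < c * \<rho> \<Longrightarrow> \<sigma> < q u \<and> p u < \<rho>" by blast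
  note w = restrict_positive_solution[OF u]
  have "\<sigma> < c * \<rho>" if "\<sigma> / c < \<rho>" using that c by (simp add: field_simps)
  then show ?thesis
    using lt by (intro bexI[OF _ w(1)]) (simp only: w(2,3), blast)
qed

lemma INF_le_sup_norm: "(INF t\<in>{a..b}. w t) \<le> sup_norm w" if "w \<in> positive_solutions f k a b c"
proof -
  have w: "continuous_on {0..1} w" using that by (simp add: positive_solutions_def cone_def C01_def)
  then have "(INF t\<in>{a..b}. w t) \<le> w a"
    using ab by (intro INF_interval_lower continuous_on_subset[OF w]) auto
  moreover have "\<bar>w a\<bar> \<le> sup_norm w" using sup_norm_le_iff[OF w, of "sup_norm w"] ab by auto
  ultimately show ?thesis by simp
qed
end

section \<open>Separating and counting the solutions\<close>

theorem theorem2p0p8: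
  fixes f :: "real \<Rightarrow> real" and k :: "real \<Rightarrow> real \<Rightarrow> real"
    and \<Phi> :: "real \<Rightarrow> real" and a b c :: real
  assumes f_cont: "continuous_on {0..} f"
    and f_nonneg: "\<And>x. x \<ge> 0 \<Longrightarrow> f x \<ge> 0"
    and k_cont: "continuous_on ({0..1} \<times> {0..1}) (\<lambda>(t, s). k t s)"
    and k_nonneg: "\<And>t s. t \<in> {0..1} \<Longrightarrow> s \<in> {0..1} \<Longrightarrow> k t s \<ge> 0"
    and Phi_cont: "continuous_on {0..1} \<Phi>"
    and Phi_nonneg: "\<And>s. s \<in> {0..1} \<Longrightarrow> \<Phi> s \<ge> 0"
    and ab: "0 \<le> a" "a \<le> b" "b \<le> 1"
    and c: "0 < c" "c \<le> 1"
    and k_upper: "\<And>t s. t \<in> {0..1} \<Longrightarrow> s \<in> {0..1} \<Longrightarrow> k t s \<le> \<Phi> s"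
    and k_lower: "\<And>t s. t \<in> {a..b} \<Longrightarrow> s \<in> {0..1} \<Longrightarrow> c * \<Phi> s \<le> k t s"
    and Phi_int: "integral {a..b} \<Phi> > 0"
  shows
    "((\<exists>\<rho>1>0. \<exists>\<rho>2>0. \<rho>1 / c < \<rho>2 \<and> cond_I0 f k a b c \<rho>1 \<and> cond_I1 f k \<rho>2) \<or>
      (\<exists>\<rho>1>0. \<exists>\<rho>2>0. \<rho>1 < \<rho>2 \<and> cond_I1 f k \<rho>1 \<and> cond_I0 f k a b c \<rho>2)
      \<longrightarrow> has_at_least 1 (positive_solutions f k a b c)) \<and>
     ((\<exists>\<rho>1>0. \<exists>\<rho>2>0. \<exists>\<rho>3>0. \<rho>1 / c < \<rho>2 \<and> \<rho>2 < \<rho>3 \<and>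
          cond_I0 f k a b c \<rho>1 \<and> cond_I1 f k \<rho>2 \<and> cond_I0 f k a b c \<rho>3) \<or>
      (\<exists>\<rho>1>0. \<exists>\<rho>2>0. \<exists>\<rho>3>0. \<rho>1 < \<rho>2 \<and> \<rho>2 / c < \<rho>3 \<and>
          cond_I1 f k \<rho>1 \<and> cond_I0 f k a b c \<rho>2 \<and> cond_I1 f k \<rho>3)
      \<longrightarrow> has_at_least 2 (positive_solutions f k a b c)) \<and>
     ((\<exists>\<rho>1>0. \<exists>\<rho>2>0. \<exists>\<rho>3>0. \<exists>\<rho>4>0. \<rho>1 / c < \<rho>2 \<and> \<rho>2 < \<rho>3 \<and> \<rho>3 / c < \<rho>4 \<and>
          cond_I0 f k a b c \<rho>1 \<and> cond_I1 f k \<rho>2 \<and> cond_I0 f k a b c \<rho>3 \<and> cond_I1 f k \<rho>4) \<or>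
      (\<exists>\<rho>1>0. \<exists>\<rho>2>0. \<exists>\<rho>3>0. \<exists>\<rho>4>0. \<rho>1 < \<rho>2 \<and> \<rho>2 / c < \<rho>3 \<and> \<rho>3 < \<rho>4 \<and>
          cond_I1 f k \<rho>1 \<and> cond_I0 f k a b c \<rho>2 \<and> cond_I1 f k \<rho>3 \<and> cond_I0 f k a b c \<rho>4)
      \<longrightarrow> has_at_least 3 (positive_solutions f k a b c))"
proof -
  interpret hammerstein f k \<Phi> a b c
    by (rule hammerstein.intro[OF assms])
  let ?S = "positive_solutions f k a b c"
  \<comment> \<open>Here \<open>m\<close> is the minimum over [a,b], not the constant
    \<open>m_const\<close>. Each pair of neighbouring radii yields one solution, located by
    \<open>m\<close> and \<open>sup_norm\<close>.\<close>
  define m where "m w = (INF t\<in>{a..b}. w t)" for w :: "real \<Rightarrow> real"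
  have m_le: "m w \<le> sup_norm w" and le_m: "sup_norm w \<le> m w / c" if "w \<in> ?S" for w
    using INF_le_sup_norm[OF that] that c
    by (simp_all add: m_def positive_solutions_def cone_def field_simps)
  have small_I0: "\<exists>w\<in>?S. \<sigma> < m w \<and> sup_norm w < \<rho>"
    if "0 < \<sigma>" "0 < \<rho>" "\<sigma> / c < \<rho>" "cond_I0 f k a b c \<sigma>" "cond_I1 f k \<rho>" for \<rho> \<sigma>
    using solution_between[OF that(5,2,4,1)] that(3) unfolding m_def by blast
  have small_I1: "\<exists>w\<in>?S. \<rho> < sup_norm w \<and> m w < \<sigma>"
    if "0 < \<rho>" "0 < \<sigma>" "\<rho> < \<sigma>" "cond_I1 f k \<rho>" "cond_I0 f k a b c \<sigma>" for \<rho> \<sigma>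
    using solution_between[OF that(4,1,5,2)] that(3) unfolding m_def by blast
  have one: "has_at_least 1 ?S" if "w \<in> ?S" for w
    unfolding has_at_least_def by (rule exI[of _ "{w}"]) (use that in simp)
  have two: "has_at_least 2 ?S" if "w \<in> ?S" "w' \<in> ?S" "w \<noteq> w'" for w w'
    unfolding has_at_least_def by (rule exI[of _ "{w, w'}"]) (use that in simp)
  have three: "has_at_least 3 ?S"
    if "w \<in> ?S" "w' \<in> ?S" "w'' \<in> ?S" "w \<noteq> w'" "w' \<noteq> w''" "w \<noteq> w''" for w w' w''
    unfolding has_at_least_def by (rule exI[of _ "{w, w', w''}"]) (use that in simp)
  show ?thesis
  proof (intro conjI impI; elim disjE exE conjE)
    fix \<rho>1 \<rho>2 :: real
    assume "0 < \<rho>1" "0 < \<rho>2" "\<rho>1 / c < \<rho>2" "cond_I0 f k a b c \<rho>1" "cond_I1 f k \<rho>2"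
    from small_I0[OF this] show "has_at_least 1 ?S" using one by blast
  next
    fix \<rho>1 \<rho>2 :: real
    assume "0 < \<rho>1" "0 < \<rho>2" "\<rho>1 < \<rho>2" "cond_I1 f k \<rho>1" "cond_I0 f k a b c \<rho>2"
    from small_I1[OF this] show "has_at_least 1 ?S" using one by blast
  next
    fix \<rho>1 \<rho>2 \<rho>3 :: real
    assume \<rho>: "0 < \<rho>1" "0 < \<rho>2" "0 < \<rho>3" "\<rho>1 / c < \<rho>2" "\<rho>2 < \<rho>3"
      and I: "cond_I0 f k a b c \<rho>1" "cond_I1 f k \<rho>2" "cond_I0 f k a b c \<rho>3"
    \<comment> \<open>The shared radius \<open>\<rho>2\<close> carries the condition on the norm, so
      the norms of the two solutions lie on opposite sides of it.\<close>
    obtain w where w: "w \<in> ?S" "sup_norm w < \<rho>2" using small_I0[OF \<rho>(1,2,4) I(1,2)] by blast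
    obtain w' where w': "w' \<in> ?S" "\<rho>2 < sup_norm w'" using small_I1[OF \<rho>(2,3,5) I(2,3)] by blast
    show "has_at_least 2 ?S" by (rule two[OF w(1) w'(1)]) (use w(2) w'(2) in auto)
  next
    fix \<rho>1 \<rho>2 \<rho>3 :: real
    assume \<rho>: "0 < \<rho>1" "0 < \<rho>2" "0 < \<rho>3" "\<rho>1 < \<rho>2" "\<rho>2 / c < \<rho>3"
      and I: "cond_I1 f k \<rho>1" "cond_I0 f k a b c \<rho>2" "cond_I1 f k \<rho>3"
    \<comment> \<open>Here \<open>\<rho>2\<close> carries the condition on the minimum, so it
      separates the minima instead.\<close>
    obtain w where w: "w \<in> ?S" "m w < \<rho>2" using small_I1[OF \<rho>(1,2,4) I(1,2)] by blast
    obtain w' where w': "w' \<in> ?S" "\<rho>2 < m w'" using small_I0[OF \<rho>(2,3,5) I(2,3)] by blast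
    show "has_at_least 2 ?S" by (rule two[OF w(1) w'(1)]) (use w(2) w'(2) in auto)
  next
    fix \<rho>1 \<rho>2 \<rho>3 \<rho>4 :: real
    assume \<rho>: "0 < \<rho>1" "0 < \<rho>2" "0 < \<rho>3" "0 < \<rho>4" "\<rho>1 / c < \<rho>2" "\<rho>2 < \<rho>3" "\<rho>3 / c < \<rho>4"
      and I: "cond_I0 f k a b c \<rho>1" "cond_I1 f k \<rho>2" "cond_I0 f k a b c \<rho>3" "cond_I1 f k \<rho>4"
    obtain w where w: "w \<in> ?S" "sup_norm w < \<rho>2" using small_I0[OF \<rho>(1,2,5) I(1,2)] by blast
    obtain w' where w': "w' \<in> ?S" "\<rho>2 < sup_norm w'" "m w' < \<rho>3"
      using small_I1[OF \<rho>(2,3,6) I(2,3)] by blast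
    obtain w'' where w'': "w'' \<in> ?S" "\<rho>3 < m w''" using small_I0[OF \<rho>(3,4,7) I(3,4)] by blast
    \<comment> \<open>Neighbouring solutions are separated by \<open>\<rho>2\<close> and
      \<open>\<rho>3\<close> as before. The outer two are compared by
      \<open>sup_norm w < \<rho>2 < \<rho>3 < m w''\<close>.\<close>
    have "sup_norm w < sup_norm w''" using w(2) w''(2) \<rho>(6) m_le[OF w''(1)] by simp
    then show "has_at_least 3 ?S"
      by (intro three[OF w(1) w'(1) w''(1)]) (use w(2) w'(2,3) w''(2) in auto)
  next
    fix \<rho>1 \<rho>2 \<rho>3 \<rho>4 :: real
    assume \<rho>: "0 < \<rho>1" "0 < \<rho>2" "0 < \<rho>3" "0 < \<rho>4" "\<rho>1 < \<rho>2" "\<rho>2 / c < \<rho>3" "\<rho>3 < \<rho>4"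
      and I: "cond_I1 f k \<rho>1" "cond_I0 f k a b c \<rho>2" "cond_I1 f k \<rho>3" "cond_I0 f k a b c \<rho>4"
    obtain w where w: "w \<in> ?S" "m w < \<rho>2" using small_I1[OF \<rho>(1,2,5) I(1,2)] by blast
    obtain w' where w': "w' \<in> ?S" "\<rho>2 < m w'" "sup_norm w' < \<rho>3"
      using small_I0[OF \<rho>(2,3,6) I(2,3)] by blast
    obtain w'' where w'': "w'' \<in> ?S" "\<rho>3 < sup_norm w''" using small_I1[OF \<rho>(3,4,7) I(3,4)] by blast
    \<comment> \<open>For the outer two, the cone inequality turns the bound on the minimum into one
      on the norm: \<open>sup_norm w \<le> m w / c < \<rho>2 / c < \<rho>3\<close>.\<close>
    have "m w / c < \<rho>2 / c" using w(2) c by (intro divide_strict_right_mono)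
    then have "sup_norm w < sup_norm w''" using le_m[OF w(1)] w''(2) \<rho>(6) by simp
    then show "has_at_least 3 ?S"
      by (intro three[OF w(1) w'(1) w''(1)]) (use w(2) w'(2,3) w''(2) in auto)
  qed
qed

end
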